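(* There is a constant $C$ such that for every $\epsilon>0$ and every integer $m\ge C(1+|\log\epsilon|)$, all but at most $\epsilon$ of the spectral mass of $\Gamma_n$ is supported on $\mathrm{Spec}(\Delta(\Gamma_m))$ for every $n\ge m$, i.e. $\nu_n\bigl(\mathbb{R}\setminus\mathrm{Spec}(\Delta(\Gamma_m))\bigr)\le\epsilon$ for all $n\ge m$. The same holds for the KNS measure: $\mu\bigl(\mathbb{R}\setminus\mathrm{Spec}(\Delta(\Gamma_m))\bigr)\le\epsilon$.
   Context: Graphs are finite undirected multigraphs, loops allowed. Each $G_n$ ($n\ge 0$) has two boundary vertices, forming $\partial G_n$. $G_0$: two vertices joined by one edge, both boundary. $G_1$: a path $a-b-c$ with a loop at $b$, $\partial G_1=\{a,c\}$. For $n\ge2$, $G_n$ is obtained from one copy of $G_{n-1}$ and two copies of $G_{n-2}$ by identifying to a single vertex both boundary vertices of $G_{n-1}$ and one boundary vertex of each copy of $G_{n-2}$; the remaining boundary vertex of each copy of $G_{n-2}$ form $\partial G_n$. $\Gamma_0$ is one vertex with two loops; for $n\ge1$, $\Gamma_n$ is obtained from a copy of $G_n$ and a copy of $G_{n-1}$ by identifying all four boundary vertices to a single vertex. $\Gamma_n$ has $2^n$ vertices. Laplacian: $\Delta(\Gamma_n)f(x)=\sum_y c_{xy}(f(x)-f(y))$, with $c_{xy}$ the number of edges joining $x,y$ (loops contribute $0$); $\mathrm{Spec}(\Delta(\Gamma_n))$ is its set of eigenvalues. The spectral counting measure is $\nu_n=2^{-n}\sum_\lambda\delta_\lambda$, the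 sum over the $2^n$ eigenvalues of $\Delta(\Gamma_n)$ counted with multiplicity. The KNS measure $\mu$ is the weak limit of $\nu_n$ as $n\to\infty$ (which exists). *)

theory Defs
  imports
    "HOL-Probability.Probability"
    "HOL-Library.Uprod"
    "HOL-Library.Function_Algebras"
begin

text \<open>Undirected multigraphs: an edge is an unordered pair, possibly degenerate (a loop), and the
  edges form a multiset.\<close>

record 'v multigraph =
  verts :: "'v set"
  edges :: "'v uprod multiset"

record 'v bgraph = "'v multigraph" +
  bdry1 :: 'v
  bdry2 :: 'v

definition map_graph :: "('v \<Rightarrow> 'w) \<Rightarrow> ('v, 'e) multigraph_scheme \<Rightarrow> 'w multigraph" where
  "map_graph h g = \<lparr>verts = h ` verts g, edges = image_mset (map_uprod h) (edges g)\<rparr>"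

definition union_graph :: "'v multigraph \<Rightarrow> 'v multigraph \<Rightarrow> 'v multigraph" where
  "union_graph g h = \<lparr>verts = verts g \<union> verts h, edges = edges g + edges h\<rparr>"

text \<open>Vertices are lists of naturals. Prefixing every vertex with a distinct number makes copies
  disjoint and keeps \<open>[]\<close> unused, so that \<open>[]\<close> can serve as the vertex to which a set of
  vertices is identified.\<close>

type_synonym vertex = "nat list"

abbreviation copy :: "nat \<Rightarrow> (vertex, 'e) multigraph_scheme \<Rightarrow> vertex multigraph" where
  "copy i g \<equiv> map_graph ((#) i) g"

definition identify :: "vertex set \<Rightarrow> vertex multigraph \<Rightarrow> vertex multigraph" where
  "identify S g = map_graph (\<lambda>x. if x \<in> S then [] else x) g"

text \<open>Each \<open>G_graph n\<close> has an automorphism exchanging its two boundary vertices, so it does not matter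
  which boundary vertex of each copy of \<open>G_graph n\<close> is glued in the recursive step.\<close>

fun G_graph :: "nat \<Rightarrow> vertex bgraph" where
  "G_graph 0 = \<lparr>verts = {[0], [1]}, edges = {#Upair [0] [1]#}, bdry1 = [0], bdry2 = [1]\<rparr>"
| "G_graph (Suc 0) = \<lparr>verts = {[0], [1], [2]},
     edges = {#Upair [0] [1], Upair [1] [1], Upair [1] [2]#}, bdry1 = [0], bdry2 = [2]\<rparr>"
| "G_graph (Suc (Suc n)) =
     (let H = G_graph (Suc n); K = G_graph n;
          g = identify {0 # bdry1 H, 0 # bdry2 H, 1 # bdry2 K, 2 # bdry1 K}
                (union_graph (copy 0 H) (union_graph (copy 1 K) (copy 2 K)))
      in \<lparr>verts = verts g, edges = edges g, bdry1 = 1 # bdry1 K, bdry2 = 2 # bdry2 K\<rparr>)"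

fun Gamma_graph :: "nat \<Rightarrow> vertex multigraph" where
  "Gamma_graph 0 = \<lparr>verts = {[]}, edges = {#Upair [] [], Upair [] []#}\<rparr>"
| "Gamma_graph (Suc n) =
     (let H = G_graph (Suc n); K = G_graph n
      in identify {0 # bdry1 H, 0 # bdry2 H, 1 # bdry1 K, 1 # bdry2 K}
           (union_graph (copy 0 H) (copy 1 K)))"

definition laplacian :: "('v, 'e) multigraph_scheme \<Rightarrow> ('v \<Rightarrow> real) \<Rightarrow> 'v \<Rightarrow> real" where
  "laplacian g f x = (\<Sum>y\<in>verts g. real (count (edges g) (Upair x y)) * (f x - f y))"

text \<open>Functions on the vertex set are represented by their extension by zero.\<close>

definition eigenspace :: "('v, 'e) multigraph_scheme \<Rightarrow> real \<Rightarrow> ('v \<Rightarrow> real) set" where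
  "eigenspace g l =
     {f. (\<forall>x. x \<notin> verts g \<longrightarrow> f x = 0) \<and> (\<forall>x\<in>verts g. laplacian g f x = l * f x)}"

definition Spec :: "('v, 'e) multigraph_scheme \<Rightarrow> real set" where
  "Spec g = {l. \<exists>f\<in>eigenspace g l. f \<noteq> (\<lambda>_. 0)}"

global_interpretation rfun: vector_space "\<lambda>(c::real) (f :: 'v \<Rightarrow> real) x. c * f x"
  by standard (auto simp: fun_eq_iff algebra_simps)

text \<open>The Laplacian is symmetric, so its eigenvalues are real and the multiplicity of an
  eigenvalue is the dimension of its eigenspace.\<close>

definition eigen_mult :: "('v, 'e) multigraph_scheme \<Rightarrow> real \<Rightarrow> nat" where
  "eigen_mult g l = rfun.dim (eigenspace g l)"

definition nu :: "nat \<Rightarrow> real measure" where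
  "nu n = distr (point_measure (Spec (Gamma_graph n)) (\<lambda>l. ennreal (real (eigen_mult (Gamma_graph n) l) / 2 ^ n)))
            borel (\<lambda>l. l)"

text \<open>The KNS measure is the weak limit of \<open>nu\<close>; weak limits are unique, so at most one measure
  satisfies this predicate.\<close>

definition is_KNS_measure :: "real measure \<Rightarrow> bool" where
  "is_KNS_measure \<mu> \<longleftrightarrow> real_distribution \<mu> \<and> weak_conv_m nu \<mu>"

end

theory Submission
  imports Defs
begin

text \<open>The two arms of a copy of \<open>G_graph k\<close> whose boundary vertices are identified can be exchanged
  by an automorphism of \<open>Gamma_graph n\<close> that fixes everything else. If an eigenfunction is not
  invariant under this exchange, its antisymmetrisation is an eigenfunction supported on the copy,
  and it can be transplanted to the looped copy of \<open>G_graph k\<close> that \<open>Gamma_graph m\<close> contains when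
  \<open>k \<le> m\<close>. So eigenfunctions with eigenvalue outside \<open>Spec (Gamma_graph m)\<close> are invariant under all
  these exchanges with \<open>k \<le> m\<close>, and the total multiplicity of such eigenvalues is at most the number
  of vertex orbits. The latter is \<open>O((19/10) ^ m * 2 ^ (n - m))\<close>. For the weak limit, the complement of
  a finite set is approximated by half-open intervals whose endpoints are not atoms.\<close>

section \<open>Orthogonal families of subspaces\<close>

text \<open>Restriction to \<open>R\<close> is injective on the span of \<open>B\<close>, so it
  carries \<open>B\<close> to an independent set inside the span of the indicators of the points of
  \<open>R\<close>. Setting values off \<open>R\<close> to 0 keeps \<open>T\<close> within one
  function space.\<close>

lemma independent_card_le_of_determining_set:
  fixes B :: "('v \<Rightarrow> real) set"
  assumes B: "rfun.independent B" and R: "finite R"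
    and det: "\<And>f. f \<in> rfun.span B \<Longrightarrow> (\<And>x. x \<in> R \<Longrightarrow> f x = 0) \<Longrightarrow> f = (\<lambda>_. 0)"
  shows "finite B \<and> card B \<le> card R"
proof -
  define T where "T f = (\<lambda>x. if x \<in> R then f x else 0)" for f :: "'v \<Rightarrow> real"
  interpret T: Vector_Spaces.linear "\<lambda>(c::real) (f :: 'v \<Rightarrow> real) x. c * f x" "\<lambda>c f x. c * f x" T
    by unfold_locales (auto simp: T_def fun_eq_iff algebra_simps)
  have inj: "inj_on T (rfun.span B)"
    unfolding T.inj_on_iff_eq_0[OF rfun.subspace_span]
    using det by (auto simp: T_def fun_eq_iff zero_fun_def split: if_splits)
  have ind: "rfun.independent (T ` B)"
    using T.independent_injective_image[OF B inj] .
  let ?e = "\<lambda>r::'v. \<lambda>x. if x = r then 1 else (0::real)"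
  have "T f \<in> rfun.span (?e ` R)" for f
  proof -
    have "T f = (\<Sum>r\<in>R. (\<lambda>x. f r * ?e r x))"
    proof
      fix x
      have "(\<Sum>r\<in>R. (\<lambda>x. f r * ?e r x)) x = (\<Sum>r\<in>R. f r * ?e r x)"
        using R by (induction R rule: finite_induct) auto
      also have "\<dots> = (\<Sum>r\<in>R. if x = r then f r else 0)"
        by (intro sum.cong) auto
      finally show "T f x = (\<Sum>r\<in>R. (\<lambda>x. f r * ?e r x)) x"
        using R by (simp add: T_def)
    qed
    also have "\<dots> \<in> rfun.span (?e ` R)"
      by (intro rfun.span_sum rfun.span_scale rfun.span_base) auto
    finally show ?thesis .
  qed
  then have "finite (T ` B) \<and> card (T ` B) \<le> card (?e ` R)"
    using R by (intro rfun.independent_span_bound ind) auto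
  moreover have "inj_on T B"
    using inj rfun.span_superset by (rule inj_on_subset)
  ultimately show ?thesis
    using card_image_le[OF R, of ?e] by (auto simp: card_image finite_image_iff)
qed

text \<open>Orthogonality merges bases of the \<open>E l\<close> into one independent subset of
  \<open>X\<close>, and \<open>R\<close> bounds the size of such subsets. This serves for
  reflection-invariant functions and, in \<open>finite_Spec\<close>, for all functions on the
  vertices.\<close>

lemma sum_dim_orthogonal_le:
  fixes E :: "real \<Rightarrow> ('v \<Rightarrow> real) set"
  assumes I: "finite I" and V: "finite V" and R: "finite R"
    and sub: "\<And>l. l \<in> I \<Longrightarrow> rfun.subspace (E l)"
    and EX: "\<And>l. l \<in> I \<Longrightarrow> E l \<subseteq> X" and X: "rfun.subspace X"
    and supp: "\<And>f x. f \<in> X \<Longrightarrow> x \<notin> V \<Longrightarrow> f x = 0"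
    and det: "\<And>f. f \<in> X \<Longrightarrow> (\<And>x. x \<in> R \<Longrightarrow> f x = 0) \<Longrightarrow> f = (\<lambda>_. 0)"
    and orth: "\<And>k l f g. k \<in> I \<Longrightarrow> l \<in> I \<Longrightarrow> k \<noteq> l \<Longrightarrow> f \<in> E k \<Longrightarrow> g \<in> E l \<Longrightarrow>
      (\<Sum>x\<in>V. f x * g x) = 0"
  shows "(\<Sum>l\<in>I. rfun.dim (E l)) \<le> card R"
proof -
  have bound: "finite B \<and> card B \<le> card R" if "rfun.independent B" "B \<subseteq> X" for B
    using that R det rfun.span_minimal[OF _ X] by (intro independent_card_le_of_determining_set) blast+
  have "\<exists>B. rfun.independent B \<and> B \<subseteq> (\<Union>l\<in>J. E l) \<and> card B = (\<Sum>l\<in>J. rfun.dim (E l))"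
    if "finite J" "J \<subseteq> I" for J
    using that
  proof (induction J rule: finite_induct)
    case empty
    show ?case using rfun.independent_empty by (intro exI[of _ "{}"]) auto
  next
    case (insert k J)
    then obtain B where B: "rfun.independent B" "B \<subseteq> (\<Union>l\<in>J. E l)"
      "card B = (\<Sum>l\<in>J. rfun.dim (E l))" by auto
    obtain C where C: "C \<subseteq> E k" "rfun.independent C" "card C = rfun.dim (E k)"
      using rfun.basis_exists by metis
    have k: "k \<in> I" using insert by auto
    have BX: "B \<subseteq> X" "C \<subseteq> X"
      using B(2) C(1) EX insert.prems by blast+
    have fin: "finite B" "finite C"
      using bound B(1) C(2) BX by auto
    \<comment> \<open>Such an \<open>f\<close> is orthogonal to all of \<open>B\<close>, hence to
      itself; the sum of squares kills it on \<open>V\<close>, the support condition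
      elsewhere.\<close>
    have zero: "f = (\<lambda>_. 0)" if f: "f \<in> E k" "f \<in> rfun.span B" for f
    proof -
      have "rfun.subspace {g. (\<Sum>x\<in>V. f x * g x) = 0}"
        by (auto simp: rfun.subspace_def algebra_simps sum.distrib simp flip: sum_distrib_left)
      moreover have "B \<subseteq> {g. (\<Sum>x\<in>V. f x * g x) = 0}"
        using B(2) insert.prems insert.hyps(2) f(1) orth[OF k] by fastforce
      ultimately have "(\<Sum>x\<in>V. f x * f x) = 0"
        using f(2) rfun.span_minimal by blast
      then have "f x = 0" if "x \<in> V" for x
        using V that by (simp add: sum_nonneg_eq_0_iff)
      moreover have "f x = 0" if "x \<notin> V" for x
        using that supp EX[OF k] f(1) by blast
      ultimately show ?thesis by (auto simp: fun_eq_iff)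
    qed
    \<comment> \<open>Disjointness makes the cardinalities, hence the dimensions, add up.\<close>
    have disj: "B \<inter> C = {}"
    proof (rule ccontr)
      assume "B \<inter> C \<noteq> {}"
      then obtain f where "f \<in> B" "f \<in> C" by auto
      then have "f = 0"
        using zero[of f] C(1) rfun.span_base[of f B] by (auto simp: zero_fun_def)
      then show False
        using \<open>f \<in> B\<close> B(1) rfun.dependent_zero by blast
    qed
    have "rfun.independent (B \<union> C)"
    proof (rule rfun.independent_if_scalars_zero)
      fix u v assume u: "(\<Sum>x\<in>B \<union> C. (\<lambda>y. u x * x y)) = 0" and v: "v \<in> B \<union> C"
      have uBC: "(\<Sum>x\<in>B. (\<lambda>y. u x * x y)) + (\<Sum>x\<in>C. (\<lambda>y. u x * x y)) = 0"
        using u sum.union_disjoint[OF fin disj] by metis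
      have inE: "(\<Sum>x\<in>C. (\<lambda>y. u x * x y)) \<in> E k"
        using C(1) by (intro rfun.subspace_sum sub k rfun.subspace_scale) auto
      have eq: "(\<Sum>x\<in>C. (\<lambda>y. u x * x y)) = - (\<Sum>x\<in>B. (\<lambda>y. u x * x y))"
        using minus_unique[OF uBC] by (rule sym)
      have "(\<Sum>x\<in>C. (\<lambda>y. u x * x y)) \<in> rfun.span B"
        unfolding eq
        by (intro rfun.span_neg rfun.span_sum rfun.span_scale rfun.span_base)
      with zero[OF inE] have "(\<Sum>x\<in>C. (\<lambda>y. u x * x y)) = 0"
        unfolding zero_fun_def by blast
      with uBC have "(\<Sum>x\<in>C. (\<lambda>y. u x * x y)) = 0" "(\<Sum>x\<in>B. (\<lambda>y. u x * x y)) = 0"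
        by simp_all
      then show "u v = 0"
        using v rfun.independentD[OF B(1) fin(1), of u v] rfun.independentD[OF C(2) fin(2), of u v]
        by auto
    qed (use fin in auto)
    moreover have "B \<union> C \<subseteq> (\<Union>l\<in>insert k J. E l)" using B C by auto
    moreover have "card (B \<union> C) = (\<Sum>l\<in>insert k J. rfun.dim (E l))"
      using B(3) C(3) insert.hyps fin disj by (simp add: card_Un_disjoint)
    ultimately show ?case by blast
  qed
  then obtain B where B: "rfun.independent B" "B \<subseteq> (\<Union>l\<in>I. E l)"
    "card B = (\<Sum>l\<in>I. rfun.dim (E l))" using I by blast
  have "B \<subseteq> X" using B(2) EX by blast
  then show ?thesis using bound[of B] B by auto
qed

section \<open>Weak limits and complements of finite sets\<close>

text \<open>Every interval \<open>{0<..<b}\<close> is uncountable, so it has points outside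
  \<open>D\<close>. This lets a radius tend to 0 while avoiding the countably many values that put
  an endpoint on an atom.\<close>

lemma tendsto_at_right_le_off_countable:
  fixes f :: "real \<Rightarrow> real"
  assumes "(f \<longlongrightarrow> l) (at_right 0)" "countable D"
    and "\<And>d. d > 0 \<Longrightarrow> d \<notin> D \<Longrightarrow> f d \<le> e"
  shows "l \<le> e"
proof (rule ccontr)
  assume "\<not> l \<le> e"
  then have "eventually (\<lambda>d. f d > e) (at_right 0)"
    using order_tendstoD(1)[OF assms(1)] by simp
  then obtain b where b: "b > 0" "\<And>d. 0 < d \<Longrightarrow> d < b \<Longrightarrow> f d > e"
    by (auto simp: eventually_at_right_field)
  have "\<not> {0<..<b} \<subseteq> D"
    using b(1) assms(2) countable_subset uncountable_open_interval by blast
  then show False using b(2) assms(3) by force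
qed

text \<open>The open-set half of the portmanteau theorem for the complement of \<open>F\<close>, by
  distribution functions: a large interval minus small intervals around the points of
  \<open>F\<close>, both scales governed by one parameter \<open>d\<close>.\<close>

lemma weak_conv_finite_complement_le:
  fixes F :: "real set"
  assumes fin: "\<And>n. finite_borel_measure (M n)" and "real_distribution \<mu>"
    and conv: "weak_conv_m M \<mu>" and F: "finite F"
    and le: "\<And>n. n \<ge> N \<Longrightarrow> measure (M n) (UNIV - F) \<le> e"
  shows "measure \<mu> (UNIV - F) \<le> e"
proof -
  interpret real_distribution \<mu> by fact
  \<comment> \<open>For \<open>d\<close> in \<open>D\<close> some endpoint is an atom of
    \<open>\<mu>\<close>, where distribution functions may fail to converge. Each endpoint
    determines \<open>d\<close>, so \<open>D\<close> is countable.\<close>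
  define D where "D = {d. d > 0 \<and> (\<exists>p\<in>{1/d, -(1/d)} \<union> (\<Union>x\<in>F. {x + d, x - d}). measure \<mu> {p} > 0)}"
  \<comment> \<open>If the small intervals overlap or leave the large one, \<open>g\<close>
    subtracts too much; it is only a lower bound for the mass off \<open>F\<close>, but for
    \<open>\<mu>\<close> it becomes exact as \<open>d\<close> tends to 0.\<close>
  define g where "g \<nu> d = (cdf \<nu> (1/d) - cdf \<nu> (-(1/d))) - (\<Sum>x\<in>F. cdf \<nu> (x + d) - cdf \<nu> (x - d))"
    for \<nu> :: "real measure" and d
  let ?A = "{p. measure \<mu> {p} > 0}"
  have "D \<subseteq> (\<lambda>p. 1/p) ` ?A \<union> (\<lambda>p. -(1/p)) ` ?A \<union> (\<Union>x\<in>F. (\<lambda>p. p - x) ` ?A \<union> (\<lambda>p. x - p) ` ?A)"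
  proof
    fix d assume "d \<in> D"
    then obtain p where d: "d > 0" and p: "p \<in> ?A"
      and *: "p = 1/d \<or> p = -(1/d) \<or> (\<exists>x\<in>F. p = x + d \<or> p = x - d)"
      unfolding D_def by blast
    then have "d = 1/p \<or> d = -(1/p) \<or> (\<exists>x\<in>F. d = p - x \<or> d = x - p)"
      by force
    then show "d \<in> (\<lambda>p. 1/p) ` ?A \<union> (\<lambda>p. -(1/p)) ` ?A \<union> (\<Union>x\<in>F. (\<lambda>p. p - x) ` ?A \<union> (\<lambda>p. x - p) ` ?A)"
      using p by blast
  qed
  moreover have "countable \<dots>"
    using countable_finite[OF F] countable_atoms by (intro countable_Un countable_UN countable_image)
  ultimately have D: "countable D" using countable_subset by blast
  have gle: "g (M n) d \<le> e" if d: "d > 0" and n: "n \<ge> N" for d n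
  proof -
    interpret Mn: finite_borel_measure "M n" by fact
    define W where "W = {-(1/d)<..1/d} - (\<Union>x\<in>F. {x-d<..x+d})"
    have "F \<in> sets borel" using F by (simp add: borel_closed finite_imp_closed)
    then have [measurable]: "W \<in> sets borel" "(\<Union>x\<in>F. {x-d<..x+d}) \<in> sets borel" "UNIV - F \<in> sets borel"
      unfolding W_def using F by (auto intro!: sets.finite_UN sets.Diff)
    have "cdf (M n) (1/d) - cdf (M n) (-(1/d)) = measure (M n) {-(1/d)<..1/d}"
    proof (rule Mn.cdf_diff_eq)
      have "1 / d > 0" using d by simp
      then show "-(1/d) < 1/d" by linarith
    qed
    also have "\<dots> \<le> measure (M n) (W \<union> (\<Union>x\<in>F. {x-d<..x+d}))"
      by (intro Mn.finite_measure_mono Mn.sets_M) (auto simp: W_def)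
    also have "\<dots> \<le> measure (M n) W + measure (M n) (\<Union>x\<in>F. {x-d<..x+d})"
      by (intro measure_Un_le Mn.sets_M) auto
    also have "measure (M n) (\<Union>x\<in>F. {x-d<..x+d}) \<le> (\<Sum>x\<in>F. measure (M n) {x-d<..x+d})"
      using F by (intro Mn.finite_measure_subadditive_finite) (auto simp: Mn.M_is_borel)
    also have "(\<Sum>x\<in>F. measure (M n) {x-d<..x+d}) = (\<Sum>x\<in>F. cdf (M n) (x + d) - cdf (M n) (x - d))"
      using d by (intro sum.cong refl Mn.cdf_diff_eq[symmetric]) auto
    finally have "g (M n) d \<le> measure (M n) W" unfolding g_def by simp
    also have "\<dots> \<le> measure (M n) (UNIV - F)"
      using d by (intro Mn.finite_measure_mono Mn.sets_M) (auto simp: W_def)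
    finally show ?thesis using le[OF n] by simp
  qed
  have good: "g \<mu> d \<le> e" if d: "d > 0" "d \<notin> D" for d
  proof -
    have c: "(\<lambda>n. cdf (M n) p) \<longlonglongrightarrow> cdf \<mu> p"
      if "p \<in> {1/d, -(1/d)} \<union> (\<Union>x\<in>F. {x + d, x - d})" for p
    proof -
      have "\<not> measure \<mu> {p} > 0"
        using that d unfolding D_def by blast
      then have "measure \<mu> {p} = 0"
        using measure_nonneg[of \<mu> "{p}"] by linarith
      then show ?thesis
        using conv isCont_cdf by (auto simp: weak_conv_m_def weak_conv_def)
    qed
    have "(\<lambda>n. g (M n) d) \<longlonglongrightarrow> g \<mu> d"
      unfolding g_def by (intro tendsto_diff tendsto_sum c) auto
    then show ?thesis
      using gle[OF d(1)] by (intro LIMSEQ_le_const2) auto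
  qed
  have atom: "((\<lambda>d. cdf \<mu> (x + d) - cdf \<mu> (x - d)) \<longlongrightarrow> measure \<mu> {x}) (at_right 0)" for x
  proof -
    have "filterlim (\<lambda>d. x + d) (at_right x) (at_right 0)" "filterlim (\<lambda>d. x - d) (at_left x) (at_right 0)"
      by (auto simp: filterlim_at eventually_at_filter intro!: tendsto_eq_intros)
    moreover have "(cdf \<mu> \<longlongrightarrow> cdf \<mu> x) (at_right x)"
      using cdf_is_right_cont by (simp add: continuous_within)
    ultimately have "((\<lambda>d. cdf \<mu> (x + d) - cdf \<mu> (x - d)) \<longlongrightarrow> cdf \<mu> x - measure \<mu> {..<x}) (at_right 0)"
      using cdf_at_left by (intro tendsto_diff) (auto intro: filterlim_compose)
    moreover have "cdf \<mu> x - measure \<mu> {..<x} = measure \<mu> {x}"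
    proof -
      have "measure \<mu> ({..x} - {..<x}) = measure \<mu> {..x} - measure \<mu> {..<x}"
        by (intro finite_measure_Diff) auto
      moreover have "{..x} - {..<x} = {x}" by auto
      ultimately show ?thesis by (simp add: cdf_def)
    qed
    ultimately show ?thesis by simp
  qed
  have inf: "filterlim (\<lambda>d::real. 1/d) at_top (at_right 0)"
    using filterlim_inverse_at_top_right by (simp add: divide_inverse)
  then have "filterlim (\<lambda>d::real. -(1/d)) at_bot (at_right 0)"
    by (simp add: filterlim_uminus_at_bot)
  with inf have "((\<lambda>d. g \<mu> d) \<longlongrightarrow> (1 - 0) - (\<Sum>x\<in>F. measure \<mu> {x})) (at_right 0)"
    unfolding g_def
    by (intro tendsto_diff tendsto_sum atom filterlim_compose[OF cdf_lim_at_top_prob]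
      filterlim_compose[OF cdf_lim_at_bot])
  moreover have "measure \<mu> (UNIV - F) = (1 - 0) - (\<Sum>x\<in>F. measure \<mu> {x})"
  proof -
    have "measure \<mu> F = (\<Sum>x\<in>F. measure \<mu> {x})"
      using F by (intro finite_measure_eq_sum_singleton) auto
    moreover have "F \<in> sets \<mu>" using F by (simp add: borel_closed finite_imp_closed)
    ultimately show ?thesis
      using prob_compl[of F] by simp
  qed
  ultimately show ?thesis
    using D good tendsto_at_right_le_off_countable by metis
qed

section \<open>The Dirichlet form\<close>

text \<open>Swapping the ends of an edge changes the sign of both factors, so the product is defined
  on unordered pairs; a loop contributes 0, as in the Laplacian.\<close>

lift_definition edge_energy :: "('v \<Rightarrow> real) \<Rightarrow> ('v \<Rightarrow> real) \<Rightarrow> 'v uprod \<Rightarrow> real"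
  is "\<lambda>\<phi> f (a, b). (\<phi> a - \<phi> b) * (f a - f b)"
  by (auto simp: algebra_simps)

lemma edge_energy_Upair [simp]: "edge_energy \<phi> f (Upair a b) = (\<phi> a - \<phi> b) * (f a - f b)"
  by transfer simp

lemma edge_energy_map_uprod [simp]:
  "edge_energy \<phi> f (map_uprod h e) = edge_energy (\<lambda>x. \<phi> (h x)) (\<lambda>x. f (h x)) e"
  by (cases e) simp

lemma edge_energy_sym: "edge_energy \<phi> f e = edge_energy f \<phi> e"
  by (cases e) simp

lemma edge_energy_diff_left:
  "edge_energy (\<lambda>x. \<phi> x - \<psi> x) f e = edge_energy \<phi> f e - edge_energy \<psi> f e"
  by (cases e) (simp add: algebra_simps)

text \<open>The weak form of the Laplacian: unlike the Laplacian it is additive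
  over the pieces of a glued graph and pulls back along the gluing maps.\<close>

definition energy :: "('v, 'e) multigraph_scheme \<Rightarrow> ('v \<Rightarrow> real) \<Rightarrow> ('v \<Rightarrow> real) \<Rightarrow> real" where
  "energy g \<phi> f = (\<Sum>e\<in>#edges g. edge_energy \<phi> f e)"

lemma energy_sym: "energy g \<phi> f = energy g f \<phi>"
proof -
  have "edge_energy \<phi> f = edge_energy f \<phi>" using edge_energy_sym by blast
  then show ?thesis by (simp add: energy_def)
qed

lemma energy_diff_left: "energy g (\<lambda>x. \<phi> x - \<psi> x) f = energy g \<phi> f - energy g \<psi> f"
proof -
  have "(\<Sum>e\<in>#M. edge_energy (\<lambda>x. \<phi> x - \<psi> x) f e) = (\<Sum>e\<in>#M. edge_energy \<phi> f e) - (\<Sum>e\<in>#M. edge_energy \<psi> f e)"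
    for M by (induction M) (simp_all add: edge_energy_diff_left)
  then show ?thesis by (simp add: energy_def)
qed

lemma energy_diff_right: "energy g \<phi> (\<lambda>x. f x - h x) = energy g \<phi> f - energy g \<phi> h"
  by (metis energy_sym energy_diff_left)

lemma energy_map_graph [simp]:
  "energy (map_graph h g) \<phi> f = energy g (\<lambda>x. \<phi> (h x)) (\<lambda>x. f (h x))"
  by (simp add: energy_def map_graph_def multiset.map_comp comp_def)

lemma energy_union_graph [simp]: "energy (union_graph g h) \<phi> f = energy g \<phi> f + energy h \<phi> f"
  by (simp add: energy_def union_graph_def)

section \<open>Images, unions and well-formed graphs\<close>

lemma map_graph_union_graph:
  "map_graph h (union_graph g g') = union_graph (map_graph h g) (map_graph h g')"
  by (simp add: map_graph_def union_graph_def image_Un)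

lemma map_graph_map_graph: "map_graph h (map_graph k g) = map_graph (h \<circ> k) g"
  by (simp add: map_graph_def image_comp multiset.map_comp uprod.map_comp comp_def)

lemma truncate_bgraph:
  "multigraph.truncate \<lparr>verts = verts g, edges = edges g, bdry1 = a, bdry2 = b\<rparr> = (g :: 'v multigraph)"
  by (cases g) (simp add: multigraph.truncate_def)

definition wf_graph :: "('v, 'e) multigraph_scheme \<Rightarrow> bool" where
  "wf_graph g \<longleftrightarrow> finite (verts g) \<and> (\<forall>e\<in>#edges g. set_uprod e \<subseteq> verts g)"

lemma wf_map_graph: "wf_graph g \<Longrightarrow> wf_graph (map_graph h g)"
  unfolding wf_graph_def map_graph_def by (auto simp: uprod.set_map)

lemma wf_union_graph: "wf_graph g \<Longrightarrow> wf_graph h \<Longrightarrow> wf_graph (union_graph g h)"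
  unfolding wf_graph_def union_graph_def by auto

lemma energy_cong:
  assumes "wf_graph g" "\<And>x. x \<in> verts g \<Longrightarrow> \<phi> x = \<psi> x" "\<And>x. x \<in> verts g \<Longrightarrow> f x = h x"
  shows "energy g \<phi> f = energy g \<psi> h"
proof -
  have "edge_energy \<phi> f e = edge_energy \<psi> h e" if "e \<in># edges g" for e
    using that assms by (cases e) (auto simp: wf_graph_def)
  then show ?thesis unfolding energy_def by (intro arg_cong[of _ _ sum_mset] image_mset_cong) auto
qed

lemma energy_eq_0:
  assumes "wf_graph g" "\<And>x. x \<in> verts g \<Longrightarrow> \<phi> x = 0"
  shows "energy g \<phi> f = 0"
proof -
  have "energy g \<phi> f = energy g (\<lambda>x. f x - f x) f"
    using assms by (intro energy_cong) auto
  then show ?thesis unfolding energy_diff_left by simp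
qed

text \<open>Summation by parts, by induction on the edge multiset with the vertex set held fixed, so
  that each step adds the contribution of a single edge.\<close>

lemma sum_laplacian:
  assumes g: "wf_graph g"
  shows "(\<Sum>x\<in>verts g. \<phi> x * laplacian g f x) = energy g \<phi> f"
proof -
  let ?V = "verts g"
  have V: "finite ?V" using g by (simp add: wf_graph_def)
  have "(\<Sum>x\<in>?V. \<phi> x * (\<Sum>y\<in>?V. real (count M (Upair x y)) * (f x - f y))) = (\<Sum>e\<in>#M. edge_energy \<phi> f e)"
    if "\<forall>e\<in>#M. set_uprod e \<subseteq> ?V" for M
    using that
  proof (induction M)
    case (add e M)
    obtain a b where e: "e = Upair a b" by (cases e)
    have ab: "a \<in> ?V" "b \<in> ?V" using add.prems by (auto simp: e)
    \<comment> \<open>An edge is seen only from its two ends, and there only through the opposite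
      end; for a loop both values are 0.\<close>
    have one: "(\<Sum>y\<in>?V. of_bool (Upair x y = e) * (f x - f y))
        = (if x = a then f a - f b else if x = b then f b - f a else 0)" for x
    proof -
      have "(\<Sum>y\<in>?V. of_bool (Upair x y = e) * (f x - f y))
        = (\<Sum>y\<in>?V. if y = (if x = a then b else a)
            then (if x = a then f a - f b else if x = b then f b - f a else 0) else 0)"
        by (intro sum.cong) (auto simp: e)
      then show ?thesis using ab V by (simp add: sum.delta)
    qed
    have "(\<Sum>x\<in>?V. \<phi> x * (\<Sum>y\<in>?V. of_bool (Upair x y = e) * (f x - f y)))
        = (\<Sum>x\<in>?V. (if x = a then \<phi> a * (f a - f b) else 0) + (if x = b then \<phi> b * (f b - f a) else 0))"
      unfolding one by (intro sum.cong) auto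
    also have "\<dots> = edge_energy \<phi> f e"
      using ab V by (simp add: sum.distrib e algebra_simps)
    finally have e1: "(\<Sum>x\<in>?V. \<phi> x * (\<Sum>y\<in>?V. of_bool (Upair x y = e) * (f x - f y))) = edge_energy \<phi> f e" .
    have cnt: "real (count (add_mset e M) u) = of_bool (u = e) + real (count M u)" for u
      by simp
    show ?case
      unfolding cnt distrib_left distrib_right sum.distrib e1 using add by simp
  qed simp
  then show ?thesis using g by (simp add: laplacian_def energy_def wf_graph_def)
qed

text \<open>Testing against point indicators recovers the pointwise equation. The weak form is the
  one that restricts to pieces and survives extension by zero.\<close>

lemma eigenspace_iff:
  assumes g: "wf_graph g"
  shows "f \<in> eigenspace g l \<longleftrightarrow>
    (\<forall>x. x \<notin> verts g \<longrightarrow> f x = 0) \<and> (\<forall>\<phi>. energy g \<phi> f = l * (\<Sum>x\<in>verts g. \<phi> x * f x))"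
proof -
  have V: "finite (verts g)" using g by (simp add: wf_graph_def)
  have "laplacian g f x = l * f x"
    if e: "\<And>\<phi>. energy g \<phi> f = l * (\<Sum>x\<in>verts g. \<phi> x * f x)" and x: "x \<in> verts g" for x
  proof -
    have "laplacian g f x = (\<Sum>y\<in>verts g. of_bool (y = x) * laplacian g f y)"
      using x V by simp
    also have "\<dots> = l * (\<Sum>y\<in>verts g. of_bool (y = x) * f y)"
      using sum_laplacian[OF g, of "\<lambda>y. of_bool (y = x)" f] e by simp
    also have "\<dots> = l * f x" using x V by simp
    finally show ?thesis .
  qed
  moreover have "energy g \<phi> f = l * (\<Sum>x\<in>verts g. \<phi> x * f x)"
    if "\<forall>x\<in>verts g. laplacian g f x = l * f x" for \<phi>
    using that by (simp add: sum_laplacian[OF g, symmetric] sum_distrib_left mult_ac)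
  ultimately show ?thesis unfolding eigenspace_def by blast
qed

lemma subspace_eigenspace: "rfun.subspace (eigenspace g l)"
proof -
  have "laplacian g (\<lambda>x. 0) = (\<lambda>x. 0)" by (simp add: laplacian_def fun_eq_iff)
  moreover have "laplacian g (\<lambda>x. f x + h x) = (\<lambda>x. laplacian g f x + laplacian g h x)" for f h
    by (simp add: laplacian_def fun_eq_iff algebra_simps sum.distrib sum_subtractf)
  moreover have "laplacian g (\<lambda>x. c * f x) = (\<lambda>x. c * laplacian g f x)" for c f
    by (simp add: laplacian_def fun_eq_iff algebra_simps sum_distrib_left)
  ultimately show ?thesis
    by (auto simp: rfun.subspace_def eigenspace_def zero_fun_def plus_fun_def algebra_simps)
qed

text \<open>By symmetry of the form, \<open>k\<close> times and \<open>l\<close> times the inner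
  product are the same energy.\<close>

lemma eigenspace_orthogonal:
  assumes g: "wf_graph g" and f: "f \<in> eigenspace g k" and h: "h \<in> eigenspace g l" and "k \<noteq> l"
  shows "(\<Sum>x\<in>verts g. f x * h x) = 0"
proof -
  have "energy g f h = l * (\<Sum>x\<in>verts g. f x * h x)" "energy g h f = k * (\<Sum>x\<in>verts g. h x * f x)"
    using f h by (auto simp: eigenspace_iff[OF g])
  then have "(k - l) * (\<Sum>x\<in>verts g. f x * h x) = 0"
    using energy_sym[of g f h] by (simp add: algebra_simps)
  then show ?thesis using \<open>k \<noteq> l\<close> by simp
qed

section \<open>The recursive structure of the graphs\<close>

declare G_graph.simps(3) [simp del] Gamma_graph.simps(2) [simp del]

text \<open>The automorphism exchanging the boundary vertices. It swaps the arms and also reflects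
  each, because one arm is glued at its second end and the other at its first. It acts on all lists
  so as to be an involution everywhere.\<close>

fun reflect :: "nat \<Rightarrow> vertex \<Rightarrow> vertex" where
  "reflect 0 v = (if v = [0] then [1] else if v = [1] then [0] else v)"
| "reflect (Suc 0) v = (if v = [0] then [2] else if v = [2] then [0] else v)"
| "reflect (Suc (Suc n)) v = (case v of [] \<Rightarrow> [] | i # x \<Rightarrow>
     if i = 1 then 2 # reflect n x else if i = 2 then 1 # reflect n x else v)"

lemma refl_refl [simp]: "reflect n (reflect n v) = v"
  by (induction n v rule: reflect.induct) (auto split: list.splits)

abbreviation "end1 n \<equiv> bdry1 (G_graph n)"
abbreviation "end2 n \<equiv> bdry2 (G_graph n)"

text \<open>This map and the next two are copying followed by identification, so the glued graph is
  a union of images. Both ends of \<open>G_graph (Suc n)\<close> go to \<open>[]\<close>, which is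
  what makes that copy looped.\<close>

definition loop_emb :: "nat \<Rightarrow> vertex \<Rightarrow> vertex" where
  "loop_emb n x = (if x = end1 (Suc n) \<or> x = end2 (Suc n) then [] else 0 # x)"

definition arm1 :: "nat \<Rightarrow> vertex \<Rightarrow> vertex" where
  "arm1 n x = (if x = end2 n then [] else 1 # x)"

definition arm2 :: "nat \<Rightarrow> vertex \<Rightarrow> vertex" where
  "arm2 n x = (if x = end1 n then [] else 2 # x)"

lemma bdry_Suc_Suc [simp]: "end1 (Suc (Suc n)) = 1 # end1 n" "end2 (Suc (Suc n)) = 2 # end2 n"
  by (simp_all add: G_graph.simps(3) Let_def)

lemma bdry_distinct [simp]: "end1 n \<noteq> end2 n"
  by (cases n rule: G_graph.cases) (simp_all)

lemma bdry_distinct' [simp]: "end2 n \<noteq> end1 n"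
  using bdry_distinct[of n] by metis

lemma refl_bdry [simp]: "reflect n (end1 n) = end2 n" "reflect n (end2 n) = end1 n"
  by (induction n rule: induct_nat_012) (simp_all)

lemma refl_eq_bdry [simp]: "reflect n x = end1 n \<longleftrightarrow> x = end2 n" "reflect n x = end2 n \<longleftrightarrow> x = end1 n"
  using refl_refl refl_bdry by metis+

lemma G_graph_Suc_Suc:
  "multigraph.truncate (G_graph (Suc (Suc n))) = union_graph (map_graph (loop_emb n) (G_graph (Suc n)))
     (union_graph (map_graph (arm1 n) (G_graph n)) (map_graph (arm2 n) (G_graph n)))"
proof -
  have "(\<lambda>x. if x \<in> {0 # end1 (Suc n), 0 # end2 (Suc n), 1 # end2 n, 2 # end1 n} then [] else x) \<circ> (#) 0 = loop_emb n"
    "(\<lambda>x. if x \<in> {0 # end1 (Suc n), 0 # end2 (Suc n), 1 # end2 n, 2 # end1 n} then [] else x) \<circ> (#) 1 = arm1 n"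
    "(\<lambda>x. if x \<in> {0 # end1 (Suc n), 0 # end2 (Suc n), 1 # end2 n, 2 # end1 n} then [] else x) \<circ> (#) 2 = arm2 n"
    by (auto simp: fun_eq_iff loop_emb_def arm1_def arm2_def)
  note * = this[symmetric]
  show ?thesis
    unfolding * by (simp only: G_graph.simps Let_def truncate_bgraph identify_def
      map_graph_union_graph map_graph_map_graph)
qed

lemma verts_G_Suc_Suc:
  "verts (G_graph (Suc (Suc n))) =
     loop_emb n ` verts (G_graph (Suc n)) \<union> arm1 n ` verts (G_graph n) \<union> arm2 n ` verts (G_graph n)"
  using arg_cong[OF G_graph_Suc_Suc, of verts n]
  by (simp add: multigraph.truncate_def union_graph_def map_graph_def Un_assoc)

lemma energy_truncate: "energy (multigraph.truncate g) = energy g"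
  by (simp add: energy_def fun_eq_iff multigraph.truncate_def)

lemma energy_G_Suc_Suc:
  "energy (G_graph (Suc (Suc n))) \<phi> f =
     energy (G_graph (Suc n)) (\<lambda>x. \<phi> (loop_emb n x)) (\<lambda>x. f (loop_emb n x))
     + energy (G_graph n) (\<lambda>x. \<phi> (arm1 n x)) (\<lambda>x. f (arm1 n x))
     + energy (G_graph n) (\<lambda>x. \<phi> (arm2 n x)) (\<lambda>x. f (arm2 n x))"
  unfolding energy_truncate[symmetric, of "G_graph (Suc (Suc n))"] G_graph_Suc_Suc by simp

lemma wf_truncate: "wf_graph (multigraph.truncate g) = wf_graph g"
  by (simp add: wf_graph_def multigraph.truncate_def)

lemma wf_G [simp]: "wf_graph (G_graph n)"
proof (induction n rule: induct_nat_012)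
  case (ge2 n)
  then show ?case
    unfolding wf_truncate[symmetric, of "G_graph (Suc (Suc n))"] G_graph_Suc_Suc
    by (intro wf_union_graph wf_map_graph) auto
qed (auto simp: wf_graph_def)

lemma bdry_in_verts [simp]: "end1 n \<in> verts (G_graph n)" "end2 n \<in> verts (G_graph n)"
  by (induction n rule: induct_nat_012) (simp_all add: verts_G_Suc_Suc arm1_def arm2_def image_iff)

lemma refl_emb [simp]:
  "reflect (Suc (Suc n)) (loop_emb n x) = loop_emb n x"
  "reflect (Suc (Suc n)) (arm1 n x) = arm2 n (reflect n x)"
  "reflect (Suc (Suc n)) (arm2 n x) = arm1 n (reflect n x)"
  by (simp_all add: loop_emb_def arm1_def arm2_def)

text \<open>Invariance of the form expresses that \<open>reflect n\<close> is an automorphism. In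
  the recursive step the loop term stays, while the arm terms are exchanged and reflected, where the
  induction hypothesis applies.\<close>

lemma energy_refl: "energy (G_graph n) (\<lambda>x. \<phi> (reflect n x)) (\<lambda>x. f (reflect n x)) = energy (G_graph n) \<phi> f"
proof (induction n arbitrary: \<phi> f rule: induct_nat_012)
  case (ge2 n)
  show ?case
    unfolding energy_G_Suc_Suc refl_emb
    using ge2.IH(1)[of "\<lambda>x. \<phi> (arm1 n x)" "\<lambda>x. f (arm1 n x)"]
      ge2.IH(1)[of "\<lambda>x. \<phi> (arm2 n x)" "\<lambda>x. f (arm2 n x)"] by simp
qed (simp_all add: energy_def algebra_simps)

section \<open>The closed graphs as two looped copies\<close>

definition loop_emb2 :: "nat \<Rightarrow> vertex \<Rightarrow> vertex" where
  "loop_emb2 n x = (if x = end1 n \<or> x = end2 n then [] else 1 # x)"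

lemma Gamma_graph_Suc:
  "Gamma_graph (Suc n) = union_graph (map_graph (loop_emb n) (G_graph (Suc n))) (map_graph (loop_emb2 n) (G_graph n))"
proof -
  have "(\<lambda>x. if x \<in> {0 # end1 (Suc n), 0 # end2 (Suc n), 1 # end1 n, 1 # end2 n} then [] else x) \<circ> (#) 0 = loop_emb n"
    "(\<lambda>x. if x \<in> {0 # end1 (Suc n), 0 # end2 (Suc n), 1 # end1 n, 1 # end2 n} then [] else x) \<circ> (#) 1 = loop_emb2 n"
    by (auto simp: fun_eq_iff loop_emb_def loop_emb2_def)
  note * = this[symmetric]
  show ?thesis
    unfolding * by (simp only: Gamma_graph.simps Let_def identify_def
      map_graph_union_graph map_graph_map_graph)
qed

lemma verts_Gamma_Suc:
  "verts (Gamma_graph (Suc n)) = loop_emb n ` verts (G_graph (Suc n)) \<union> loop_emb2 n ` verts (G_graph n)"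
  unfolding Gamma_graph_Suc by (simp add: union_graph_def map_graph_def)

lemma energy_Gamma_Suc:
  "energy (Gamma_graph (Suc n)) \<phi> f =
     energy (G_graph (Suc n)) (\<lambda>x. \<phi> (loop_emb n x)) (\<lambda>x. f (loop_emb n x))
     + energy (G_graph n) (\<lambda>x. \<phi> (loop_emb2 n x)) (\<lambda>x. f (loop_emb2 n x))"
  unfolding Gamma_graph_Suc by simp

lemma wf_Gamma [simp]: "wf_graph (Gamma_graph n)"
proof (cases n)
  case (Suc k)
  then show ?thesis
    by (simp only: Gamma_graph_Suc) (intro wf_union_graph wf_map_graph wf_G)
qed (simp add: wf_graph_def)

section \<open>Inner vertices and their decomposition\<close>

definition inner_verts :: "nat \<Rightarrow> vertex set" where
  "inner_verts n = verts (G_graph n) - {end1 n, end2 n}"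

lemma inner_verts_0: "inner_verts 0 = {}"
  by (auto simp: inner_verts_def)

lemma inner_verts_1: "inner_verts (Suc 0) = {[1]}"
  by (auto simp: inner_verts_def)

lemma emb_simps:
  "x \<in> inner_verts (Suc n) \<Longrightarrow> loop_emb n x = 0 # x"
  "x \<in> inner_verts n \<Longrightarrow> arm1 n x = 1 # x"
  "x \<in> inner_verts n \<Longrightarrow> arm2 n x = 2 # x"
  "x \<in> inner_verts n \<Longrightarrow> loop_emb2 n x = 1 # x"
  "loop_emb n (end1 (Suc n)) = []" "loop_emb n (end2 (Suc n)) = []"
  "arm1 n (end1 n) = end1 (Suc (Suc n))" "arm1 n (end2 n) = []"
  "arm2 n (end1 n) = []" "arm2 n (end2 n) = end2 (Suc (Suc n))"
  "loop_emb2 n (end1 n) = []" "loop_emb2 n (end2 n) = []"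
  by (auto simp: inner_verts_def loop_emb_def arm1_def arm2_def loop_emb2_def)

lemma bdry_notin_inner [simp]: "end1 n \<notin> inner_verts n" "end2 n \<notin> inner_verts n"
  by (auto simp: inner_verts_def)

lemma verts_G_inner: "verts (G_graph n) = insert (end1 n) (insert (end2 n) (inner_verts n))"
  by (auto simp: inner_verts_def)

lemma inner_Suc_Suc:
  "inner_verts (Suc (Suc n)) =
     insert [] ((#) 0 ` inner_verts (Suc n) \<union> (#) 1 ` inner_verts n \<union> (#) 2 ` inner_verts n)"
proof -
  have "verts (G_graph (Suc (Suc n))) = insert (end1 (Suc (Suc n))) (insert (end2 (Suc (Suc n)))
      (insert [] ((#) 0 ` inner_verts (Suc n) \<union> (#) 1 ` inner_verts n \<union> (#) 2 ` inner_verts n)))"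
    unfolding verts_G_Suc_Suc verts_G_inner[of "Suc n"] verts_G_inner[of n]
    by (auto simp: emb_simps image_iff simp del: bdry_Suc_Suc)
  then show ?thesis
    unfolding inner_verts_def[of "Suc (Suc n)"] by (auto)
qed

lemma refl_inner: "x \<in> inner_verts n \<Longrightarrow> reflect n x \<in> inner_verts n"
proof (induction n arbitrary: x rule: induct_nat_012)
  case (ge2 n)
  then show ?case by (auto simp: inner_Suc_Suc)
qed (auto simp: inner_verts_0 inner_verts_1)

lemma bij_refl: "bij_betw (reflect n) (inner_verts n) (inner_verts n)"
  by (rule bij_betw_byWitness[where f' = "reflect n"]) (auto intro: refl_inner)

section \<open>Pieces and reflection invariance\<close>

text \<open>The map \<open>h\<close> exhibits a copy of \<open>G_graph n\<close> inside \<open>g\<close> that is attached to the rest of \<open>g\<close> only at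
  its boundary, whose two vertices may be identified with each other.\<close>

definition piece :: "(vertex, 'e) multigraph_scheme \<Rightarrow> nat \<Rightarrow> (vertex \<Rightarrow> vertex) \<Rightarrow> bool" where
  "piece g n h \<longleftrightarrow> inj_on h (inner_verts n) \<and> h ` inner_verts n \<subseteq> verts g \<and>
     h (end1 n) \<notin> h ` inner_verts n \<and> h (end2 n) \<notin> h ` inner_verts n \<and>
     (\<forall>\<phi> f. (\<forall>y. y \<notin> h ` inner_verts n \<longrightarrow> \<phi> y = 0) \<longrightarrow>
        energy g \<phi> f = energy (G_graph n) (\<lambda>x. \<phi> (h x)) (\<lambda>x. f (h x)))"

abbreviation looped :: "nat \<Rightarrow> (vertex \<Rightarrow> vertex) \<Rightarrow> bool" where
  "looped n h \<equiv> h (end1 n) = h (end2 n)"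

lemma pieceD:
  assumes "piece g n h"
  shows "inj_on h (inner_verts n)" "h ` inner_verts n \<subseteq> verts g"
    "h (end1 n) \<notin> h ` inner_verts n" "h (end2 n) \<notin> h ` inner_verts n"
    "(\<And>y. y \<notin> h ` inner_verts n \<Longrightarrow> \<phi> y = 0) \<Longrightarrow>
        energy g \<phi> f = energy (G_graph n) (\<lambda>x. \<phi> (h x)) (\<lambda>x. f (h x))"
  using assms unfolding piece_def by auto

text \<open>A test function supported inside one of the three copies vanishes on the other two, so a
  single term of the energy decomposition survives. The central copy is looped whatever
  \<open>h\<close> does at the ends.\<close>

lemma subpieces:
  assumes h: "piece g (Suc (Suc n)) h"
  shows "piece g (Suc n) (\<lambda>x. h (loop_emb n x))"
    and "piece g n (\<lambda>x. h (arm1 n x))"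
    and "piece g n (\<lambda>x. h (arm2 n x))"
proof -
  let ?V = "\<lambda>n. verts (G_graph n)" and ?I = "inner_verts"
  let ?N = "Suc (Suc n)"
  have sub: "(#) 0 ` ?I (Suc n) \<subseteq> ?I ?N" "(#) 1 ` ?I n \<subseteq> ?I ?N" "(#) 2 ` ?I n \<subseteq> ?I ?N"
    by (auto simp: inner_Suc_Suc)
  have emb: "loop_emb n x \<in> ?V ?N" if "x \<in> ?V (Suc n)" for x
    using that by (auto simp: verts_G_Suc_Suc)
  have emb': "arm1 n x \<in> ?V ?N" "arm2 n x \<in> ?V ?N" if "x \<in> ?V n" for x
    using that by (auto simp: verts_G_Suc_Suc)
  \<comment> \<open>\<open>h\<close> is injective on inner vertices only; the ends are covered by
    the requirement that their images avoid the image of the inside.\<close>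
  have out: "h y \<notin> h ` S" if S: "S \<subseteq> ?I ?N" and y: "y \<notin> S" "y \<in> ?V ?N" for S y
  proof (cases "y \<in> ?I ?N")
    case True
    then show ?thesis
      using inj_on_image_mem_iff[OF pieceD(1)[OF h] True S] y(1) by blast
  next
    case False
    then have "y = end1 ?N \<or> y = end2 ?N"
      using y(2) unfolding verts_G_inner by blast
    then show ?thesis
      using pieceD(3,4)[OF h] S by blast
  qed
  have energy: "energy g \<phi> f =
     energy (G_graph (Suc n)) (\<lambda>x. \<phi> (h (loop_emb n x))) (\<lambda>x. f (h (loop_emb n x)))
     + energy (G_graph n) (\<lambda>x. \<phi> (h (arm1 n x))) (\<lambda>x. f (h (arm1 n x)))
     + energy (G_graph n) (\<lambda>x. \<phi> (h (arm2 n x))) (\<lambda>x. f (h (arm2 n x)))"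
    if "S \<subseteq> ?I ?N" "\<And>y. y \<notin> h ` S \<Longrightarrow> \<phi> y = 0" for \<phi> f S
    using that pieceD(5)[OF h, of \<phi> f] by (subst energy_G_Suc_Suc[symmetric]) blast
  \<comment> \<open>The common part of the three cases: \<open>e\<close> is the embedding and
    \<open>i\<close> the prefix it puts on inner vertices; the energy identity \<open>en\<close> is
    left to each case.\<close>
  have piece_intro: "piece g k (\<lambda>x. h (e x))"
    if e: "\<And>x. x \<in> ?I k \<Longrightarrow> e x = i # x" and S: "(#) i ` ?I k \<subseteq> ?I ?N"
      and bd: "e (end1 k) \<notin> (#) i ` ?I k" "e (end1 k) \<in> ?V ?N" "e (end2 k) \<notin> (#) i ` ?I k" "e (end2 k) \<in> ?V ?N"
      and en: "\<And>\<phi> f. (\<And>y. y \<in> ?V ?N \<Longrightarrow> y \<notin> (#) i ` ?I k \<Longrightarrow> \<phi> (h y) = 0) \<Longrightarrow>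
        (\<And>y. y \<notin> h ` (#) i ` ?I k \<Longrightarrow> \<phi> y = 0) \<Longrightarrow>
        energy g \<phi> f = energy (G_graph k) (\<lambda>x. \<phi> (h (e x))) (\<lambda>x. f (h (e x)))"
    for k e i
  proof -
    have img: "(\<lambda>x. h (e x)) ` ?I k = h ` (#) i ` ?I k"
      by (simp add: image_image e)
    have "inj_on (\<lambda>x. h (e x)) (?I k)"
    proof (rule inj_onI)
      fix x y assume xy: "x \<in> ?I k" "y \<in> ?I k" "h (e x) = h (e y)"
      then have "i # x = i # y"
        using inj_onD[OF pieceD(1)[OF h], of "i # x" "i # y"] e S by auto
      then show "x = y" by simp
    qed
    moreover have "h ` (#) i ` ?I k \<subseteq> verts g"
      using S pieceD(2)[OF h] by blast
    ultimately show ?thesis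
      unfolding piece_def img
    proof (intro conjI allI impI)
      show "h (e (end1 k)) \<notin> h ` (#) i ` ?I k" "h (e (end2 k)) \<notin> h ` (#) i ` ?I k"
        using out[OF S] bd by blast+
      fix \<phi> f assume \<phi>: "\<forall>y. y \<notin> h ` (#) i ` ?I k \<longrightarrow> \<phi> y = (0::real)"
      show "energy g \<phi> f = energy (G_graph k) (\<lambda>x. \<phi> (h (e x))) (\<lambda>x. f (h (e x)))"
      proof (rule en)
        show "\<phi> (h y) = 0" if "y \<in> ?V ?N" "y \<notin> (#) i ` ?I k" for y
          using \<phi> out[OF S that(2,1)] by blast
      qed (use \<phi> in blast)
    qed
  qed
  show "piece g (Suc n) (\<lambda>x. h (loop_emb n x))"
  proof (rule piece_intro[OF emb_simps(1) sub(1)])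
    fix \<phi> f :: "vertex \<Rightarrow> real"
    assume \<phi>: "\<And>y. y \<in> ?V ?N \<Longrightarrow> y \<notin> (#) 0 ` ?I (Suc n) \<Longrightarrow> \<phi> (h y) = 0"
      and \<phi>': "\<And>y. y \<notin> h ` (#) 0 ` ?I (Suc n) \<Longrightarrow> \<phi> y = 0"
    have "\<phi> (h (arm1 n x)) = 0" if "x \<in> ?V n" for x
      by (rule \<phi>[OF emb'(1)[OF that]]) (auto simp: arm1_def)
    moreover have "\<phi> (h (arm2 n x)) = 0" if "x \<in> ?V n" for x
      by (rule \<phi>[OF emb'(2)[OF that]]) (auto simp: arm2_def)
    ultimately show "energy g \<phi> f =
        energy (G_graph (Suc n)) (\<lambda>x. \<phi> (h (loop_emb n x))) (\<lambda>x. f (h (loop_emb n x)))"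
      using energy[OF sub(1), of \<phi> f, OF \<phi>'] by (simp add: energy_eq_0)
  qed (auto simp: emb_simps inner_Suc_Suc verts_G_inner simp del: bdry_Suc_Suc)
  show "piece g n (\<lambda>x. h (arm1 n x))"
  proof (rule piece_intro[OF emb_simps(2) sub(2)])
    fix \<phi> f :: "vertex \<Rightarrow> real"
    assume \<phi>: "\<And>y. y \<in> ?V ?N \<Longrightarrow> y \<notin> (#) 1 ` ?I n \<Longrightarrow> \<phi> (h y) = 0"
      and \<phi>': "\<And>y. y \<notin> h ` (#) 1 ` ?I n \<Longrightarrow> \<phi> y = 0"
    have "\<phi> (h (arm2 n x)) = 0" if "x \<in> ?V n" for x
      by (rule \<phi>[OF emb'(2)[OF that]]) (auto simp: arm2_def)
    moreover have "\<phi> (h (loop_emb n x)) = 0" if "x \<in> ?V (Suc n)" for x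
      by (rule \<phi>[OF emb[OF that]]) (auto simp: loop_emb_def)
    ultimately show "energy g \<phi> f = energy (G_graph n) (\<lambda>x. \<phi> (h (arm1 n x))) (\<lambda>x. f (h (arm1 n x)))"
      using energy[OF sub(2), of \<phi> f, OF \<phi>'] by (simp add: energy_eq_0)
  next
    show "arm1 n (end1 n) \<notin> (#) 1 ` ?I n" by (auto simp: arm1_def)
  qed (auto simp: emb_simps inner_Suc_Suc verts_G_inner simp del: bdry_Suc_Suc)
  show "piece g n (\<lambda>x. h (arm2 n x))"
  proof (rule piece_intro[OF emb_simps(3) sub(3)])
    fix \<phi> f :: "vertex \<Rightarrow> real"
    assume \<phi>: "\<And>y. y \<in> ?V ?N \<Longrightarrow> y \<notin> (#) 2 ` ?I n \<Longrightarrow> \<phi> (h y) = 0"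
      and \<phi>': "\<And>y. y \<notin> h ` (#) 2 ` ?I n \<Longrightarrow> \<phi> y = 0"
    have "\<phi> (h (arm1 n x)) = 0" if "x \<in> ?V n" for x
      by (rule \<phi>[OF emb'(1)[OF that]]) (auto simp: arm1_def)
    moreover have "\<phi> (h (loop_emb n x)) = 0" if "x \<in> ?V (Suc n)" for x
      by (rule \<phi>[OF emb[OF that]]) (auto simp: loop_emb_def)
    ultimately show "energy g \<phi> f = energy (G_graph n) (\<lambda>x. \<phi> (h (arm2 n x))) (\<lambda>x. f (h (arm2 n x)))"
      using energy[OF sub(3), of \<phi> f, OF \<phi>'] by (simp add: energy_eq_0)
  next
    show "arm2 n (end2 n) \<notin> (#) 2 ` ?I n" by (auto simp: arm2_def)
  qed (auto simp: emb_simps inner_Suc_Suc verts_G_inner simp del: bdry_Suc_Suc)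
qed

text \<open>The two copies meet only in \<open>[]\<close>, which is not the image of an inner vertex
  of either, so a test function supported inside one vanishes on the other.\<close>

lemma Gamma_pieces:
  "piece (Gamma_graph (Suc n)) (Suc n) (loop_emb n)" "looped (Suc n) (loop_emb n)"
  "piece (Gamma_graph (Suc n)) n (loop_emb2 n)" "looped n (loop_emb2 n)"
proof -
  have I: "loop_emb n ` inner_verts (Suc n) = (#) 0 ` inner_verts (Suc n)"
    "loop_emb2 n ` inner_verts n = (#) 1 ` inner_verts n"
    by (auto simp: emb_simps image_iff)
  show "looped (Suc n) (loop_emb n)" "looped n (loop_emb2 n)"
    by (simp_all only: emb_simps)
  show "piece (Gamma_graph (Suc n)) (Suc n) (loop_emb n)"
    unfolding piece_def energy_Gamma_Suc
  proof (intro conjI allI impI)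
    fix \<phi> f :: "vertex \<Rightarrow> real"
    assume \<phi>: "\<forall>y. y \<notin> loop_emb n ` inner_verts (Suc n) \<longrightarrow> \<phi> y = 0"
    have "\<phi> (loop_emb2 n x) = 0" for x
      using \<phi> by (auto simp: I loop_emb2_def)
    then show "energy (G_graph (Suc n)) (\<lambda>x. \<phi> (loop_emb n x)) (\<lambda>x. f (loop_emb n x))
      + energy (G_graph n) (\<lambda>x. \<phi> (loop_emb2 n x)) (\<lambda>x. f (loop_emb2 n x))
      = energy (G_graph (Suc n)) (\<lambda>x. \<phi> (loop_emb n x)) (\<lambda>x. f (loop_emb n x))"
      by (simp add: energy_eq_0)
  qed (auto simp: verts_Gamma_Suc I emb_simps inj_on_def verts_G_inner )
  show "piece (Gamma_graph (Suc n)) n (loop_emb2 n)"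
    unfolding piece_def energy_Gamma_Suc
  proof (intro conjI allI impI)
    fix \<phi> f :: "vertex \<Rightarrow> real"
    assume \<phi>: "\<forall>y. y \<notin> loop_emb2 n ` inner_verts n \<longrightarrow> \<phi> y = 0"
    have "\<phi> (loop_emb n x) = 0" for x
      using \<phi> by (auto simp: I loop_emb_def)
    then show "energy (G_graph (Suc n)) (\<lambda>x. \<phi> (loop_emb n x)) (\<lambda>x. f (loop_emb n x))
      + energy (G_graph n) (\<lambda>x. \<phi> (loop_emb2 n x)) (\<lambda>x. f (loop_emb2 n x))
      = energy (G_graph n) (\<lambda>x. \<phi> (loop_emb2 n x)) (\<lambda>x. f (loop_emb2 n x))"
      by (simp add: energy_eq_0)
  qed (auto simp: verts_Gamma_Suc I emb_simps inj_on_def verts_G_inner )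
qed

text \<open>Downward induction from \<open>m\<close>: \<open>Gamma_graph m\<close> is built from a
  looped \<open>G_graph m\<close>, and each \<open>G_graph (Suc k)\<close> with positive
  \<open>k\<close> has a looped \<open>G_graph k\<close> at its centre.\<close>

lemma looped_piece_exists:
  assumes "2 \<le> k" "k \<le> m"
  shows "\<exists>h. piece (Gamma_graph m) k h \<and> looped k h"
  using assms(2,1)
proof (induction k rule: inc_induct)
  case base
  then obtain n where "m = Suc n" by (cases m) auto
  then show ?case using Gamma_pieces by blast
next
  case (step k)
  then obtain h where h: "piece (Gamma_graph m) (Suc k) h" by auto
  obtain n where "k = Suc n" using step by (cases k) auto
  then show ?case
    using subpieces(1)[of _ n h] h emb_simps(5,6)[of n] by (metis (no_types, lifting))
qed

text \<open>The hypothesis on \<open>\<psi>\<close> says that \<open>u\<close> is an eigenfunction of \<open>G_graph n\<close> with its two boundary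
  vertices identified; as \<open>u\<close> vanishes there, it stays one after extension by zero.\<close>

lemma piece_eigenfunction:
  assumes g: "wf_graph g" and h: "piece g n h" "looped n h"
    and u: "\<And>x. x \<notin> inner_verts n \<Longrightarrow> u x = 0"
    and eig: "\<And>\<psi>. \<psi> (end1 n) = \<psi> (end2 n) \<Longrightarrow>
      energy (G_graph n) \<psi> u = l * (\<Sum>x\<in>inner_verts n. \<psi> x * u x)"
    and nz: "u x \<noteq> 0"
  shows "l \<in> Spec g"
proof -
  let ?I = "inner_verts n"
  define f where "f y = (if y \<in> h ` ?I then u (the_inv_into ?I h y) else 0)" for y
  have fh: "f (h x) = u x" if "x \<in> ?I" for x
    using that pieceD(1)[OF h(1)] by (simp add: f_def the_inv_into_f_f)
  have fh': "f (h x) = u x" if "x \<in> verts (G_graph n)" for x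
    using that fh u[of "end1 n"] u[of "end2 n"] pieceD(3,4)[OF h(1)]
    by (auto simp: verts_G_inner f_def)
  have "f \<in> eigenspace g l"
    unfolding eigenspace_iff[OF g]
  proof (intro conjI allI impI)
    show "f y = 0" if "y \<notin> verts g" for y
      using that pieceD(2)[OF h(1)] by (auto simp: f_def)
    fix \<phi>
    \<comment> \<open>The supported function must stand in the first place to restrict to the piece,
      so the symmetry of the form is used on both sides.\<close>
    have "energy g \<phi> f = energy (G_graph n) (\<lambda>x. \<phi> (h x)) (\<lambda>x. f (h x))"
      using pieceD(5)[OF h(1), of f \<phi>] by (subst (1 2) energy_sym) (simp add: f_def)
    also have "\<dots> = energy (G_graph n) (\<lambda>x. \<phi> (h x)) u"
      using fh' by (intro energy_cong) auto
    \<comment> \<open>Loopedness makes the pulled-back test function agree at the two ends, as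
      \<open>eig\<close> requires.\<close>
    also have "\<dots> = l * (\<Sum>x\<in>?I. \<phi> (h x) * u x)"
      using h(2) by (intro eig) simp
    also have "(\<Sum>x\<in>?I. \<phi> (h x) * u x) = (\<Sum>y\<in>h ` ?I. \<phi> y * f y)"
      using pieceD(1)[OF h(1)] by (simp add: sum.reindex fh)
    also have "\<dots> = (\<Sum>y\<in>verts g. \<phi> y * f y)"
      using pieceD(2)[OF h(1)] g by (intro sum.mono_neutral_left) (auto simp: wf_graph_def f_def)
    finally show "energy g \<phi> f = l * (\<Sum>y\<in>verts g. \<phi> y * f y)" .
  qed
  moreover have "f \<noteq> (\<lambda>_. 0)"
    using fh[of x] nz u[of x] by metis
  ultimately show ?thesis by (auto simp: Spec_def)
qed

text \<open>The antisymmetric part of \<open>f\<close> on the piece vanishes at the identified ends,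
  so it solves the eigenvalue equation of the looped \<open>G_graph n\<close> alone. Were it
  nonzero, \<open>piece_eigenfunction\<close> would put \<open>l\<close> into
  \<open>Spec g'\<close>.\<close>

lemma eigenfunction_refl_invariant:
  assumes g: "wf_graph g" and f: "f \<in> eigenspace g l" and g': "wf_graph g'" and l: "l \<notin> Spec g'"
    and h: "piece g n h" "looped n h" and h': "piece g' n h'" "looped n h'"
    and x: "x \<in> inner_verts n"
  shows "f (h (reflect n x)) = f (h x)"
proof (rule ccontr)
  assume neq: "f (h (reflect n x)) \<noteq> f (h x)"
  let ?I = "inner_verts n"
  define w where "w x = f (h x)" for x
  define u where "u x = (if x \<in> ?I then w x - w (reflect n x) else 0)" for x
  have u: "u x = w x - w (reflect n x)" if "x \<in> verts (G_graph n)" for x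
    using that h(2) by (auto simp: u_def verts_G_inner w_def)
  have "energy (G_graph n) \<psi> u = l * (\<Sum>x\<in>?I. \<psi> x * u x)" if \<psi>: "\<psi> (end1 n) = \<psi> (end2 n)" for \<psi>
  proof -
    \<comment> \<open>The antisymmetrisation is moved to the test function: \<open>\<theta>\<close>
      vanishes at both ends because \<open>\<psi>\<close> agrees there, so its extension by zero
      \<open>\<phi>\<close> can be tested against \<open>f\<close> in \<open>g\<close>.\<close>
    define \<theta> where "\<theta> x = \<psi> x - \<psi> (reflect n x)" for x
    define \<phi> where "\<phi> y = (if y \<in> h ` ?I then \<theta> (the_inv_into ?I h y) else 0)" for y
    have \<phi>I: "\<phi> (h x) = \<theta> x" if "x \<in> ?I" for x
      using that pieceD(1)[OF h(1)] by (simp add: \<phi>_def the_inv_into_f_f)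
    have \<phi>h: "\<phi> (h x) = \<theta> x" if "x \<in> verts (G_graph n)" for x
      using that \<phi>I pieceD(3,4)[OF h(1)] \<psi>
      by (auto simp: verts_G_inner \<phi>_def \<theta>_def)
    have "energy (G_graph n) \<psi> u = energy (G_graph n) \<psi> (\<lambda>x. w x - w (reflect n x))"
      using u by (intro energy_cong) auto
    also have "\<dots> = energy (G_graph n) \<psi> w - energy (G_graph n) \<psi> (\<lambda>x. w (reflect n x))"
      by (rule energy_diff_right)
    also have "energy (G_graph n) \<psi> (\<lambda>x. w (reflect n x)) = energy (G_graph n) (\<lambda>x. \<psi> (reflect n x)) w"
      using energy_refl[of n "\<lambda>x. \<psi> (reflect n x)" w] by simp
    also have "energy (G_graph n) \<psi> w - \<dots> = energy (G_graph n) \<theta> w"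
      by (simp add: \<theta>_def[abs_def] energy_diff_left)
    also have "\<dots> = energy (G_graph n) (\<lambda>x. \<phi> (h x)) (\<lambda>x. f (h x))"
      using \<phi>h by (intro energy_cong) (auto simp: w_def)
    also have "\<dots> = energy g \<phi> f"
      using pieceD(5)[OF h(1), of \<phi> f] by (simp add: \<phi>_def)
    also have "\<dots> = l * (\<Sum>y\<in>verts g. \<phi> y * f y)"
      using f by (simp add: eigenspace_iff[OF g])
    also have "(\<Sum>y\<in>verts g. \<phi> y * f y) = (\<Sum>y\<in>h ` ?I. \<phi> y * f y)"
      using pieceD(2)[OF h(1)] g by (intro sum.mono_neutral_right) (auto simp: wf_graph_def \<phi>_def)
    also have "\<dots> = (\<Sum>x\<in>?I. \<theta> x * w x)"
      using pieceD(1)[OF h(1)] by (simp add: sum.reindex \<phi>I w_def)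
    also have "\<dots> = (\<Sum>x\<in>?I. \<psi> x * w x) - (\<Sum>x\<in>?I. \<psi> (reflect n x) * w x)"
      by (simp add: \<theta>_def left_diff_distrib sum_subtractf)
    \<comment> \<open>Reindexing by the involution returns the reflection from the test function to
      \<open>w\<close>.\<close>
    also have "(\<Sum>x\<in>?I. \<psi> (reflect n x) * w x) = (\<Sum>x\<in>?I. \<psi> x * w (reflect n x))"
      using sum.reindex_bij_betw[OF bij_refl, of "\<lambda>x. \<psi> (reflect n x) * w x" n] by simp
    also have "(\<Sum>x\<in>?I. \<psi> x * w x) - \<dots> = (\<Sum>x\<in>?I. \<psi> x * u x)"
      by (simp add: u_def right_diff_distrib sum_subtractf)
    finally show ?thesis .
  qed
  moreover have "u x \<noteq> 0" using x neq by (auto simp: u_def w_def)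
  ultimately have "l \<in> Spec g'"
    using piece_eigenfunction[OF g' h', of u l x] by (auto simp: u_def)
  with l show False by simp
qed

section \<open>Counting orbits\<close>

text \<open>Levels 0 and 1 are left out because their reflections move no inner vertex. Quantifying
  over all \<open>h\<close> spares an enumeration of the looped pieces.\<close>

definition refl_invariant :: "nat \<Rightarrow> vertex multigraph \<Rightarrow> (vertex \<Rightarrow> real) set" where
  "refl_invariant m g = {f. (\<forall>x. x \<notin> verts g \<longrightarrow> f x = 0) \<and>
     (\<forall>k h x. 2 \<le> k \<longrightarrow> k \<le> m \<longrightarrow> piece g k h \<longrightarrow> looped k h \<longrightarrow> x \<in> inner_verts k \<longrightarrow>
        f (h (reflect k x)) = f (h x))}"

lemma subspace_refl_invariant: "rfun.subspace (refl_invariant m g)"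
  by (auto simp: rfun.subspace_def refl_invariant_def)

lemma eigenspace_subset_refl_invariant:
  assumes "wf_graph g" "l \<notin> Spec (Gamma_graph m)"
  shows "eigenspace g l \<subseteq> refl_invariant m g"
proof
  fix f assume f: "f \<in> eigenspace g l"
  have "f (h (reflect k x)) = f (h x)"
    if "2 \<le> k" "k \<le> m" "piece g k h" "looped k h" "x \<in> inner_verts k" for k h x
    using that looped_piece_exists[of k m] assms f eigenfunction_refl_invariant[of g f l "Gamma_graph m"]
    by (metis wf_Gamma)
  then show "f \<in> refl_invariant m g"
    using f by (auto simp: refl_invariant_def eigenspace_def)
qed

text \<open>\<open>orbits m b n\<close> bounds the number of orbits of inner vertices of a copy of \<open>G_graph n\<close>, looped if
  \<open>b\<close>, under the reflections of looped pieces of level at most \<open>m\<close>.\<close>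

fun orbits :: "nat \<Rightarrow> bool \<Rightarrow> nat \<Rightarrow> nat" where
  "orbits m b 0 = 0"
| "orbits m b (Suc 0) = 1"
| "orbits m b (Suc (Suc n)) =
     1 + orbits m True (Suc n) + (if b \<and> Suc (Suc n) \<le> m then 1 else 2) * orbits m False n"

text \<open>\<open>R\<close> consists of the glued vertex, a set for the central copy, which is
  looped and gets the flag \<open>True\<close>, and sets for the arms, which get
  \<open>False\<close>. For a looped piece of level at most \<open>m\<close> the reflection ties the
  second arm to the first, so one arm set is enough.\<close>

lemma determining_set_piece:
  assumes "piece g n h" "b \<Longrightarrow> looped n h"
  shows "\<exists>R. finite R \<and> card R \<le> orbits m b n \<and>
    (\<forall>f\<in>refl_invariant m g. f (h (end1 n)) = 0 \<longrightarrow> f (h (end2 n)) = 0 \<longrightarrow> (\<forall>y\<in>R. f y = 0) \<longrightarrow>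
       (\<forall>x\<in>inner_verts n. f (h x) = 0))"
  using assms
proof (induction n arbitrary: h b rule: induct_nat_012)
  case 0
  then show ?case by (intro exI[of _ "{}"]) (auto simp: inner_verts_0)
next
  case 1
  then show ?case by (intro exI[of _ "{h [1]}"]) (auto simp: inner_verts_1)
next
  case (ge2 n)
  note sp = subpieces[OF ge2.prems(1)]
  \<comment> \<open>Both ends of the central copy are mapped to \<open>h []\<close>, whence the
    repeated premise.\<close>
  obtain R0 where R0: "finite R0" "card R0 \<le> orbits m True (Suc n)"
    and R00: "\<forall>f\<in>refl_invariant m g. f (h []) = 0 \<longrightarrow> f (h []) = 0 \<longrightarrow> (\<forall>y\<in>R0. f y = 0) \<longrightarrow>
       (\<forall>x\<in>inner_verts (Suc n). f (h (loop_emb n x)) = 0)"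
    using ge2.IH(2)[OF sp(1), of True] unfolding emb_simps by blast
  have R0_det: "f (h (0 # x)) = 0" if "f \<in> refl_invariant m g" "f (h []) = 0" "f (h []) = 0"
    "\<And>y. y \<in> R0 \<Longrightarrow> f y = 0" "x \<in> inner_verts (Suc n)" for f x
    using R00 that emb_simps(1)[OF that(5)] by (metis (no_types, lifting))
  obtain R1 where R1: "finite R1" "card R1 \<le> orbits m False n"
    and R10: "\<forall>f\<in>refl_invariant m g. f (h (end1 (Suc (Suc n)))) = 0 \<longrightarrow> f (h []) = 0 \<longrightarrow> (\<forall>y\<in>R1. f y = 0) \<longrightarrow>
       (\<forall>x\<in>inner_verts n. f (h (arm1 n x)) = 0)"
    using ge2.IH(1)[OF sp(2), of False] unfolding emb_simps by blast
  have R1_det: "f (h (1 # x)) = 0" if "f \<in> refl_invariant m g" "f (h (end1 (Suc (Suc n)))) = 0" "f (h []) = 0"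
    "\<And>y. y \<in> R1 \<Longrightarrow> f y = 0" "x \<in> inner_verts n" for f x
    using R10 that emb_simps(2)[OF that(5)] by (metis (no_types, lifting))
  obtain R2 where R2: "finite R2" "card R2 \<le> orbits m False n"
    and R20: "\<forall>f\<in>refl_invariant m g. f (h []) = 0 \<longrightarrow> f (h (end2 (Suc (Suc n)))) = 0 \<longrightarrow> (\<forall>y\<in>R2. f y = 0) \<longrightarrow>
       (\<forall>x\<in>inner_verts n. f (h (arm2 n x)) = 0)"
    using ge2.IH(1)[OF sp(3), of False] unfolding emb_simps by blast
  have R2_det: "f (h (2 # x)) = 0" if "f \<in> refl_invariant m g" "f (h []) = 0" "f (h (end2 (Suc (Suc n)))) = 0"
    "\<And>y. y \<in> R2 \<Longrightarrow> f y = 0" "x \<in> inner_verts n" for f x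
    using R20 that emb_simps(3)[OF that(5)] by (metis (no_types, lifting))
  show ?case
  proof (cases "b \<and> Suc (Suc n) \<le> m")
    case True
    have "f (h x) = 0" if f: "f \<in> refl_invariant m g" "f (h (end1 (Suc (Suc n)))) = 0"
      "f (h (end2 (Suc (Suc n)))) = 0" "\<forall>y\<in>insert (h []) (R0 \<union> R1). f y = 0"
      "x \<in> inner_verts (Suc (Suc n))" for f x
    proof -
      have "f (h (2 # y)) = 0" if y: "y \<in> inner_verts n" for y
      proof -
        have "f (h (reflect (Suc (Suc n)) (2 # y))) = f (h (2 # y))"
          using f(1) True ge2.prems y unfolding refl_invariant_def
          by (auto simp: inner_Suc_Suc simp del: reflect.simps bdry_Suc_Suc)
        then show ?thesis
          using R1_det[OF f(1,2) _ _ refl_inner[OF y]] f(4) by simp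
      qed
      then show ?thesis
        using f R0_det[OF f(1)] R1_det[OF f(1,2)] by (auto simp: inner_Suc_Suc)
    qed
    moreover have "card (insert (h []) (R0 \<union> R1)) \<le> Suc (card R0 + card R1)"
      using card_insert_le_m1 card_Un_le[of R0 R1] R0(1) R1(1) by (simp add: card_insert_if)
    ultimately show ?thesis
      using True R0 R1 by (intro exI[of _ "insert (h []) (R0 \<union> R1)"]) auto
  next
    case False
    have "f (h x) = 0" if f: "f \<in> refl_invariant m g" "f (h (end1 (Suc (Suc n)))) = 0"
      "f (h (end2 (Suc (Suc n)))) = 0" "\<forall>y\<in>insert (h []) (R0 \<union> R1 \<union> R2). f y = 0"
      "x \<in> inner_verts (Suc (Suc n))" for f x
      using f R0_det[OF f(1)] R1_det[OF f(1,2)] R2_det[OF f(1) _ f(3)] by (auto simp: inner_Suc_Suc)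
    moreover have "card (insert (h []) (R0 \<union> R1 \<union> R2)) \<le> Suc (card R0 + card R1 + card R2)"
      using card_Un_le[of R0 R1] card_Un_le[of "R0 \<union> R1" R2] R0(1) R1(1) R2(1) by (simp add: card_insert_if)
    ultimately show ?thesis
      using False R0 R1 R2 by (intro exI[of _ "insert (h []) (R0 \<union> R1 \<union> R2)"]) auto
  qed
qed

text \<open>The growth rate of \<open>orbits\<close> up to level \<open>m\<close> is the root 1.80... of \<open>x ^ 3 = x ^ 2 + 2 * x - 1\<close>;
  any rate between it and 2 would do.\<close>

lemma orbits_le:
  "n \<le> m \<Longrightarrow> real (orbits m b n) + of_bool (\<not> b) \<le> (if b then 2 else 3) * (19/10) ^ n"
proof (induction m b n rule: orbits.induct)
  case (3 m b n)
  \<comment> \<open>After division by \<open>(19/10) ^ n\<close> the cases need 6.8 \<le> 7.22 for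
    \<open>b\<close> and 9.8 \<le> 10.83 otherwise; the extra 1 in the second bound cancels the
    additive constants.\<close>
  have "real (orbits m True (Suc n)) \<le> 2 * (19/10) ^ Suc n" "real (orbits m False n) + 1 \<le> 3 * (19/10) ^ n"
    using 3 by simp_all
  then show ?case using "3.prems" by (cases b) auto
qed auto

text \<open>Above level \<open>m\<close> the recursion is that of the full vertex count, with
  leading root 2; up to \<open>m\<close>, \<open>orbits_le\<close> gives the rate 19/10. The added 1
  absorbs the constant term, and the exponent is a truncated difference, 0 for
  \<open>n < m\<close>.\<close>

lemma orbits_le':
  "real (orbits m b n) + 1 \<le> 2 ^ (n + 1 - m) * (3 * (19/10) ^ m)"
proof -
  have three: "3 \<le> 2 ^ k * (3 * (19/10::real) ^ m)" for k m
    using mult_mono[of 1 "2 ^ k" 3 "3 * (19/10::real) ^ m"] by simp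
  show ?thesis
  proof (induction m b n rule: orbits.induct)
    case (3 m b n)
    show ?case
    proof (cases "Suc (Suc n) \<le> m")
      case True
      define r where "r = (19/10 :: real) ^ m"
      have r: "1 \<le> r" by (simp add: r_def)
      have "real (orbits m b (Suc (Suc n))) + of_bool (\<not> b) \<le> (if b then 2 else 3) * (19/10) ^ Suc (Suc n)"
        using orbits_le[OF True] .
      also have "\<dots> \<le> (if b then 2 else 3) * r"
        unfolding r_def using True by (intro mult_left_mono power_increasing) auto
      finally have "real (orbits m b (Suc (Suc n))) + 1 \<le> 1 * (3 * r)"
        using r by (cases b) (simp_all del: orbits.simps)
      also have "1 * (3 * r) \<le> 2 ^ (Suc (Suc n) + 1 - m) * (3 * r)"
        using r by (intro mult_right_mono one_le_power) auto
      finally show ?thesis by (simp only: r_def)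
    next
      case False
      define B where "B = 3 * (19/10::real) ^ m"
      have 1: "real (orbits m True (Suc n)) + 1 \<le> 2 ^ (Suc n + 1 - m) * B"
        and 2: "real (orbits m False n) + 1 \<le> 2 ^ (n + 1 - m) * B"
        using 3 by (simp_all add: B_def)
      \<comment> \<open>Here \<open>m \<le> n + 1\<close>; the \<open>+ 1\<close> in the exponent
        keeps the differences exact even when equality holds.\<close>
      have e: "Suc n + 1 - m = Suc (n + 1 - m)" "Suc (Suc n) + 1 - m = Suc (Suc (n + 1 - m))"
        using False by auto
      show ?thesis
        using 1 2 False unfolding e B_def[symmetric] by (auto simp: algebra_simps)
    qed
  next
    case (1 m b)
    show ?case using three[of "0 + 1 - m" m] by simp
  next
    case (2 m b)
    show ?case using three[of "Suc 0 + 1 - m" m] by simp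
  qed
qed

text \<open>One determining set for each of the two looped copies, plus the glued vertex. The copies
  of levels \<open>n\<close> and \<open>n - 1\<close> contribute 2 * 3 and 3 to the constant 9; the
  glued vertex is absorbed by the added 1 in \<open>orbits_le'\<close>.\<close>

lemma determining_set_Gamma:
  assumes "m \<le> n"
  shows "\<exists>R. finite R \<and> real (card R) \<le> 9 * (19/10) ^ m * 2 ^ (n - m) \<and>
    (\<forall>f\<in>refl_invariant m (Gamma_graph n). (\<forall>y\<in>R. f y = 0) \<longrightarrow> f = (\<lambda>_. 0))"
proof (cases n)
  case 0
  then have "f = (\<lambda>_. 0)" if "f \<in> refl_invariant m (Gamma_graph n)" "f [] = 0" for f
    using that by (auto simp: refl_invariant_def fun_eq_iff) metis
  then show ?thesis
    using assms 0 by (intro exI[of _ "{[]}"]) auto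
next
  case (Suc k)
  note pc = Gamma_pieces[of k]
  obtain R0 where R0: "finite R0" "card R0 \<le> orbits m True (Suc k)"
    and R0_det: "\<forall>f\<in>refl_invariant m (Gamma_graph (Suc k)). f [] = 0 \<longrightarrow> f [] = 0 \<longrightarrow> (\<forall>y\<in>R0. f y = 0) \<longrightarrow>
       (\<forall>x\<in>inner_verts (Suc k). f (loop_emb k x) = 0)"
    using determining_set_piece[OF pc(1,2), where b = True and m = m] unfolding emb_simps by blast
  obtain R1 where R1: "finite R1" "card R1 \<le> orbits m True k"
    and R1_det: "\<forall>f\<in>refl_invariant m (Gamma_graph (Suc k)). f [] = 0 \<longrightarrow> f [] = 0 \<longrightarrow> (\<forall>y\<in>R1. f y = 0) \<longrightarrow>
       (\<forall>x\<in>inner_verts k. f (loop_emb2 k x) = 0)"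
    using determining_set_piece[OF pc(3,4), where b = True and m = m] unfolding emb_simps by blast
  let ?R = "insert [] (R0 \<union> R1)"
  have "f = (\<lambda>_. 0)" if f: "f \<in> refl_invariant m (Gamma_graph n)" "\<forall>y\<in>?R. f y = 0" for f
  proof
    fix y
    have "f (loop_emb k x) = 0" if "x \<in> verts (G_graph (Suc k))" for x
      using that f R0_det Suc by (auto simp: verts_G_inner emb_simps)
    moreover have "f (loop_emb2 k x) = 0" if "x \<in> verts (G_graph k)" for x
      using that f R1_det Suc by (auto simp: verts_G_inner emb_simps)
    moreover have "f y = 0" if "y \<notin> verts (Gamma_graph (Suc k))"
      using that f(1) Suc by (simp add: refl_invariant_def)
    ultimately show "f y = 0" unfolding verts_Gamma_Suc by blast
  qed
  moreover have "real (card ?R) \<le> 9 * (19/10) ^ m * 2 ^ (n - m)"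
  proof -
    have "card ?R \<le> orbits m True (Suc k) + orbits m True k + 1"
      using card_Un_le[of R0 R1] R0 R1 by (simp add: card_insert_if)
    then have "real (card ?R) \<le> (real (orbits m True (Suc k)) + 1) + (real (orbits m True k) + 1)"
      by linarith
    also have "\<dots> \<le> 2 ^ (Suc k + 1 - m) * (3 * (19/10) ^ m) + 2 ^ (k + 1 - m) * (3 * (19/10) ^ m)"
      by (intro add_mono orbits_le')
    also have "\<dots> = 9 * (19/10) ^ m * 2 ^ (n - m)"
    proof -
      have "Suc k + 1 - m = Suc (n - m)" "k + 1 - m = n - m"
        using assms Suc by auto
      then show ?thesis by simp
    qed
    finally show ?thesis .
  qed
  ultimately show ?thesis
    using R0(1) R1(1) by (intro exI[of _ ?R]) auto
qed

section \<open>Multiplicities and finiteness of the spectrum\<close>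

lemma sum_eigen_mult_le:
  assumes "m \<le> n" "finite I" "I \<inter> Spec (Gamma_graph m) = {}"
  shows "(\<Sum>l\<in>I. real (eigen_mult (Gamma_graph n) l)) \<le> 9 * (19/10) ^ m * 2 ^ (n - m)"
proof -
  let ?g = "Gamma_graph n"
  obtain R where R: "finite R" "real (card R) \<le> 9 * (19/10) ^ m * 2 ^ (n - m)"
    and det: "\<forall>f\<in>refl_invariant m ?g. (\<forall>y\<in>R. f y = 0) \<longrightarrow> f = (\<lambda>_. 0)"
    using determining_set_Gamma[OF assms(1)] by blast
  have "(\<Sum>l\<in>I. rfun.dim (eigenspace ?g l)) \<le> card R"
  proof (rule sum_dim_orthogonal_le[where V = "verts ?g" and X = "refl_invariant m ?g"])
    show "finite (verts ?g)" using wf_Gamma[of n] by (simp only: wf_graph_def)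
    show "eigenspace ?g l \<subseteq> refl_invariant m ?g" if "l \<in> I" for l
      using that assms(3) by (intro eigenspace_subset_refl_invariant) auto
    show "f x = 0" if "f \<in> refl_invariant m ?g" "x \<notin> verts ?g" for f x
      using that by (simp add: refl_invariant_def)
    show "(\<Sum>x\<in>verts ?g. f x * h x) = 0"
      if "k \<noteq> l" "f \<in> eigenspace ?g k" "h \<in> eigenspace ?g l" for k l f h
      using that by (intro eigenspace_orthogonal) auto
    show "f = (\<lambda>_. 0)" if "f \<in> refl_invariant m ?g" "\<And>x. x \<in> R \<Longrightarrow> f x = 0" for f
      using that det by blast
  qed (use assms(2) R(1) in \<open>auto intro: subspace_eigenspace subspace_refl_invariant\<close>)
  then have "(\<Sum>l\<in>I. eigen_mult ?g l) \<le> card R" by (simp add: eigen_mult_def)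
  then have "real (\<Sum>l\<in>I. eigen_mult ?g l) \<le> real (card R)" by (rule of_nat_mono)
  then show ?thesis using R(2) by simp
qed

text \<open>One eigenfunction per eigenvalue spans a line of dimension 1; the lines are orthogonal,
  and the vertex set itself is determining.\<close>

lemma finite_Spec:
  assumes g: "wf_graph g"
  shows "finite (Spec g)"
proof (rule finite_if_finite_subsets_card_bdd[THEN conjunct1])
  fix I assume I: "I \<subseteq> Spec g" "finite I"
  have V: "finite (verts g)" using g by (simp add: wf_graph_def)
  have "\<exists>f. f \<in> eigenspace g l \<and> f \<noteq> 0" if "l \<in> I" for l
    using that I by (auto simp: Spec_def zero_fun_def)
  then obtain F where F: "\<And>l. l \<in> I \<Longrightarrow> F l \<in> eigenspace g l" "\<And>l. l \<in> I \<Longrightarrow> F l \<noteq> 0" by metis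
  let ?X = "{f. \<forall>x. x \<notin> verts g \<longrightarrow> f x = 0}"
  have span: "rfun.span {F l} \<subseteq> eigenspace g l" if "l \<in> I" for l
    using F(1)[OF that] by (intro rfun.span_minimal subspace_eigenspace) auto
  have "(\<Sum>l\<in>I. rfun.dim (rfun.span {F l})) \<le> card (verts g)"
  proof (rule sum_dim_orthogonal_le[OF I(2) V V rfun.subspace_span, of _ ?X])
    show "rfun.span {F l} \<subseteq> ?X" if "l \<in> I" for l
      using span[OF that] by (auto simp: eigenspace_def)
    show "rfun.subspace ?X" by (auto simp: rfun.subspace_def)
    show "(\<Sum>x\<in>verts g. f x * h x) = 0"
      if "k \<in> I" "l \<in> I" "k \<noteq> l" "f \<in> rfun.span {F k}" "h \<in> rfun.span {F l}" for k l f h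
      using that span by (intro eigenspace_orthogonal[OF g]) auto
  qed auto
  moreover have "rfun.dim (rfun.span {F l}) = 1" if "l \<in> I" for l
    using F(2)[OF that] by (subst rfun.dim_span_eq_card_independent) auto
  ultimately show "card I \<le> card (verts g)" by simp
qed

section \<open>The spectral measures\<close>

lemma emeasure_nu:
  assumes "A \<in> sets borel"
  shows "emeasure (nu n) A =
    ennreal (\<Sum>l\<in>Spec (Gamma_graph n) \<inter> A. real (eigen_mult (Gamma_graph n) l) / 2 ^ n)"
proof -
  let ?P = "point_measure (Spec (Gamma_graph n)) (\<lambda>l. ennreal (real (eigen_mult (Gamma_graph n) l) / 2 ^ n))"
  have "emeasure (nu n) A = emeasure ?P ((\<lambda>l. l) -` A \<inter> space ?P)"
    unfolding nu_def using assms
    by (intro emeasure_distr) (auto simp: measurable_def space_point_measure sets_point_measure)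
  also have "(\<lambda>l. l) -` A \<inter> space ?P = Spec (Gamma_graph n) \<inter> A"
    by (auto simp: space_point_measure)
  also have "emeasure ?P \<dots> = (\<Sum>l\<in>Spec (Gamma_graph n) \<inter> A. ennreal (real (eigen_mult (Gamma_graph n) l) / 2 ^ n))"
    using finite_Spec[OF wf_Gamma] by (intro emeasure_point_measure_finite) auto
  finally show ?thesis by simp
qed

lemma finite_borel_measure_nu: "finite_borel_measure (nu n)"
proof -
  have "sets (nu n) = sets borel" by (simp add: nu_def)
  moreover from this have "emeasure (nu n) (space (nu n)) \<noteq> \<infinity>"
    by (subst emeasure_nu) (auto dest: sets_eq_imp_space_eq)
  ultimately show ?thesis
    unfolding finite_borel_measure_def finite_borel_measure_axioms_def by (auto intro: finite_measureI)
qed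

text \<open>Dividing the multiplicity bound by \<open>2 ^ n\<close> cancels \<open>n\<close>; a
  bound uniform in \<open>n\<close> is what passes to the weak limit.\<close>

lemma nu_complement_le:
  assumes "m \<le> n"
  shows "measure (nu n) (UNIV - Spec (Gamma_graph m)) \<le> 9 * (19/20) ^ m"
proof -
  let ?I = "Spec (Gamma_graph n) \<inter> (UNIV - Spec (Gamma_graph m))"
  have "Spec (Gamma_graph m) \<in> sets borel"
    using finite_Spec[OF wf_Gamma] by (simp add: borel_closed finite_imp_closed)
  then have "measure (nu n) (UNIV - Spec (Gamma_graph m)) = (\<Sum>l\<in>?I. real (eigen_mult (Gamma_graph n) l)) / 2 ^ n"
    unfolding measure_def by (subst emeasure_nu) (auto simp: sum_divide_distrib sum_nonneg)
  also have "\<dots> \<le> (9 * (19/10) ^ m * 2 ^ (n - m)) / 2 ^ n"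
    using assms finite_Spec[OF wf_Gamma] by (intro divide_right_mono sum_eigen_mult_le) auto
  also have "\<dots> = 9 * (19/20) ^ m"
    using assms by (simp add: power_diff power_divide field_simps flip: power_mult_distrib)
  finally show ?thesis .
qed

theorem theorem5p8:
  shows "\<exists>C::real. \<forall>\<epsilon>::real. \<forall>m::nat. \<epsilon> > 0 \<longrightarrow> real m \<ge> C * (1 + \<bar>ln \<epsilon>\<bar>) \<longrightarrow>
           (\<forall>n\<ge>m. measure (nu n) (UNIV - Spec (Gamma_graph m)) \<le> \<epsilon>) \<and>
           (\<forall>\<mu>. is_KNS_measure \<mu> \<longrightarrow> measure \<mu> (UNIV - Spec (Gamma_graph m)) \<le> \<epsilon>)"
proof (intro exI allI impI)
  fix \<epsilon> :: real and m :: nat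
  \<comment> \<open>The goal \<open>9 * (19/20) ^ m \<le> \<epsilon>\<close> means that
    \<open>m * ln (20/19)\<close> is at least \<open>ln 9 - ln \<epsilon>\<close>. As
    \<open>ln 9 \<ge> 1\<close>, the factor \<open>ln 9\<close> in the constant also covers the term
    \<open>\<bar>ln \<epsilon>\<bar>\<close>.\<close>
  assume \<epsilon>: "\<epsilon> > 0" and m: "real m \<ge> ln 9 / ln (20/19) * (1 + \<bar>ln \<epsilon>\<bar>)"
  have "(1::real) \<le> ln 9"
    using exp_le by (subst ln_ge_iff) auto
  then have "ln 9 + \<bar>ln \<epsilon>\<bar> \<le> ln 9 * (1 + \<bar>ln \<epsilon>\<bar>)"
    using mult_right_mono[of 1 "ln 9" "\<bar>ln \<epsilon>\<bar>"] by (simp add: algebra_simps)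
  also have "\<dots> \<le> real m * ln (20/19)"
    using m by (simp add: field_simps)
  finally have "ln 9 + real m * ln (19/20) \<le> ln \<epsilon>"
    by (simp add: ln_div algebra_simps)
  then have "ln (9 * (19/20) ^ m) \<le> ln \<epsilon>"
    by (simp add: ln_mult ln_realpow)
  then have le: "9 * (19/20) ^ m \<le> \<epsilon>"
    using \<epsilon> by (subst (asm) ln_le_cancel_iff) auto
  have nu: "measure (nu n) (UNIV - Spec (Gamma_graph m)) \<le> \<epsilon>" if "n \<ge> m" for n
    using nu_complement_le[OF that] le by linarith
  show "(\<forall>n\<ge>m. measure (nu n) (UNIV - Spec (Gamma_graph m)) \<le> \<epsilon>) \<and>
    (\<forall>\<mu>. is_KNS_measure \<mu> \<longrightarrow> measure \<mu> (UNIV - Spec (Gamma_graph m)) \<le> \<epsilon>)"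
  proof (intro conjI allI impI)
    fix \<mu> assume "is_KNS_measure \<mu>"
    then show "measure \<mu> (UNIV - Spec (Gamma_graph m)) \<le> \<epsilon>"
      unfolding is_KNS_measure_def
      by (intro weak_conv_finite_complement_le[OF finite_borel_measure_nu _ _ finite_Spec[OF wf_Gamma] nu]) auto
  qed (rule nu)
qed

end
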